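(* Let $\mathbf A$ be a finite algebra. The following are equivalent: (1) $c_{\mathbf A}(n) \in O(n^k)$ for some integer $k$; (2) no subalgebra of $\mathbf A$ (including $\mathbf A$ itself) has a nontrivial strongly abelian congruence.
   Context: An algebra is a set with interpretations of the function symbols of a purely functional signature (each symbol has a nonnegative integer arity). For a finite algebra $\mathbf A$, $c_{\mathbf A}(n)$ denotes the maximum of $|\mathrm{Hom}(\mathbf X,\mathbf A)|$ over all algebras $\mathbf X$ in the signature of $\mathbf A$ with at most $n$ elements. For an algebra $\mathbf A$ and $k\ge 1$, $\mathrm{Clo}_k(\mathbf A)$ is the set of $k$-ary term operations of $\mathbf A$. A congruence $\alpha$ of $\mathbf A$ is strongly abelian if for every $k\ge1$, every $t\in \mathrm{Clo}_k(\mathbf A)$ and all $x_1,\dots,x_k,y_1,\dots,y_k,z_2,\dots,z_k\in A$ with $(x_i,y_i)\in\alpha$ for $1\le i\le k$ and $(y_i,z_i)\in\alpha$ for $2\le i\le k$, the equality $t(x_1,\dots,x_k)=t(y_1,\dots,y_k)$ implies $t(x_1,z_2,\dots,z_k)=t(y_1,z_2,\dots,z_k)$. The congruence $0_A$ (equality) is the trivial congruence; all others are nontrivial. *)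

theory Defs
  imports Complex_Main "HOL-Library.Landau_Symbols"
begin

text \<open>A signature is a map ar from function symbols to arities. An algebra of that
signature is given by a carrier set and an interpretation of each symbol as an
operation on argument lists (only lists of the right length over the carrier matter).\<close>

definition is_algebra :: "('f \<Rightarrow> nat) \<Rightarrow> 'a set \<Rightarrow> ('f \<Rightarrow> 'a list \<Rightarrow> 'a) \<Rightarrow> bool" where
  "is_algebra ar A F \<longleftrightarrow>
     (\<forall>f xs. length xs = ar f \<and> set xs \<subseteq> A \<longrightarrow> F f xs \<in> A)"

definition is_hom :: "('f \<Rightarrow> nat) \<Rightarrow> 'b set \<Rightarrow> ('f \<Rightarrow> 'b list \<Rightarrow> 'b)
    \<Rightarrow> 'a set \<Rightarrow> ('f \<Rightarrow> 'a list \<Rightarrow> 'a) \<Rightarrow> ('b \<Rightarrow> 'a) \<Rightarrow> bool" where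
  "is_hom ar X G A F h \<longleftrightarrow>
     (\<forall>x\<in>X. h x \<in> A) \<and>
     (\<forall>f xs. length xs = ar f \<and> set xs \<subseteq> X \<longrightarrow> h (G f xs) = F f (map h xs))"

definition homs :: "('f \<Rightarrow> nat) \<Rightarrow> 'b set \<Rightarrow> ('f \<Rightarrow> 'b list \<Rightarrow> 'b)
    \<Rightarrow> 'a set \<Rightarrow> ('f \<Rightarrow> 'a list \<Rightarrow> 'a) \<Rightarrow> ('b \<Rightarrow> 'a) set" where
  "homs ar X G A F = {h. is_hom ar X G A F h \<and> (\<forall>x. x \<notin> X \<longrightarrow> h x = undefined)}"

text \<open>c_A(n): maximum of |Hom(X,A)| over algebras X with at most n elements.
Every such algebra is isomorphic to one whose carrier is a subset of nat.\<close>
definition count_fun :: "('f \<Rightarrow> nat) \<Rightarrow> 'a set \<Rightarrow> ('f \<Rightarrow> 'a list \<Rightarrow> 'a) \<Rightarrow> nat \<Rightarrow> nat" where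
  "count_fun ar A F n = Sup {card (homs ar X G A F) | (X :: nat set) G.
      is_algebra ar X G \<and> finite X \<and> card X \<le> n}"

definition subalgebra :: "('f \<Rightarrow> nat) \<Rightarrow> 'a set \<Rightarrow> ('f \<Rightarrow> 'a list \<Rightarrow> 'a) \<Rightarrow> 'a set \<Rightarrow> bool" where
  "subalgebra ar A F B \<longleftrightarrow> B \<subseteq> A \<and> is_algebra ar B F"

definition congruence :: "('f \<Rightarrow> nat) \<Rightarrow> 'a set \<Rightarrow> ('f \<Rightarrow> 'a list \<Rightarrow> 'a) \<Rightarrow> 'a rel \<Rightarrow> bool" where
  "congruence ar A F \<alpha> \<longleftrightarrow> equiv A \<alpha> \<and>
     (\<forall>f xs ys. length xs = ar f \<and> length ys = ar f \<and>
        (\<forall>i < ar f. (xs ! i, ys ! i) \<in> \<alpha>) \<longrightarrow> (F f xs, F f ys) \<in> \<alpha>)"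

datatype 'f trm = Var nat | App 'f "'f trm list"

fun eval_trm :: "('f \<Rightarrow> 'a list \<Rightarrow> 'a) \<Rightarrow> (nat \<Rightarrow> 'a) \<Rightarrow> 'f trm \<Rightarrow> 'a" where
  "eval_trm F e (Var i) = e i"
| "eval_trm F e (App f ts) = F f (map (eval_trm F e) ts)"

fun wf_trm :: "('f \<Rightarrow> nat) \<Rightarrow> nat \<Rightarrow> 'f trm \<Rightarrow> bool" where
  "wf_trm ar k (Var i) \<longleftrightarrow> i < k"
| "wf_trm ar k (App f ts) \<longleftrightarrow> length ts = ar f \<and> (\<forall>t\<in>set ts. wf_trm ar k t)"

text \<open>Strongly abelian congruence; variables x_1..x_k are indexed 0..k-1.\<close>
definition strongly_abelian :: "('f \<Rightarrow> nat) \<Rightarrow> 'a set \<Rightarrow> ('f \<Rightarrow> 'a list \<Rightarrow> 'a) \<Rightarrow> 'a rel \<Rightarrow> bool" where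
  "strongly_abelian ar A F \<alpha> \<longleftrightarrow>
     (\<forall>k \<ge> 1. \<forall>t. wf_trm ar k t \<longrightarrow>
       (\<forall>x y z :: nat \<Rightarrow> 'a.
          (\<forall>i<k. x i \<in> A \<and> y i \<in> A \<and> z i \<in> A) \<and>
          (\<forall>i<k. (x i, y i) \<in> \<alpha>) \<and>
          (\<forall>i. 1 \<le> i \<and> i < k \<longrightarrow> (y i, z i) \<in> \<alpha>) \<and>
          eval_trm F x t = eval_trm F y t
          \<longrightarrow> eval_trm F (z(0 := x 0)) t = eval_trm F (z(0 := y 0)) t))"

end

theory Submission
  imports Defs "HOL-Library.FuncSet"
begin

text \<open>If a subalgebra has a nontrivial strongly abelian congruence \<open>\<alpha>\<close>, pick \<open>(a, b) \<in> \<alpha>\<close> with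
  \<open>a \<noteq> b\<close> and consider the \<open>m\<close>-ary term operations restricted to \<open>{a, b}\<^sup>m\<close>. By strong
  abelianness each of them is injective in every variable it depends on, so it depends on boundedly
  many variables. Hence there are only polynomially many of them, while evaluation at the points of
  \<open>{a, b}\<^sup>m\<close> gives \<open>2\<^sup>m\<close> homomorphisms.

  Conversely, fix an algebra \<open>X\<close> with \<open>n\<close> elements. After splitting the homomorphisms into
  polynomially many groups we may assume that they all have the same image \<open>B\<close> and that \<open>X\<close>,
  viewed as a set of functions on a group \<open>J\<close> of homomorphisms, contains the constants from \<open>B\<close>;
  it is then closed under all polynomials of \<open>B\<close>. Some element of \<open>X\<close> takes two different values
  \<open>a\<close>, \<open>b\<close> on \<open>J\<close>, on parts \<open>J\<^sub>a\<close> and \<open>J\<^sub>b\<close>. Tame congruence theory provides a binary polynomial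
  that acts trivially when its second argument is \<open>a\<close> and disturbs (or erases) when it is \<open>b\<close>, or the
  reverse. Therefore the number of patterns that \<open>X\<close> induces on \<open>J\<^sub>a \<union> J\<^sub>b\<close> is, up to a constant
  factor on the smaller part, superadditive, and induction shows that \<open>card J\<close> is bounded by a power
  of \<open>n\<close>.\<close>

section \<open>Polynomials and principal congruences\<close>

text \<open>Polynomial operations: term operations in which constants from \<open>A\<close> are
  allowed. The argument is an assignment to all variables at once, so arities need not be tracked
  and substitution is plain composition.\<close>

inductive polyf :: "('f \<Rightarrow> nat) \<Rightarrow> 'a set \<Rightarrow> ('f \<Rightarrow> 'a list \<Rightarrow> 'a) \<Rightarrow> ((nat \<Rightarrow> 'a) \<Rightarrow> 'a) \<Rightarrow> bool"
  for ar A F where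
  var: "polyf ar A F (\<lambda>e. e i)"
| const: "c \<in> A \<Longrightarrow> polyf ar A F (\<lambda>e. c)"
| app: "length ps = ar f \<Longrightarrow> (\<And>p. p \<in> set ps \<Longrightarrow> polyf ar A F p)
    \<Longrightarrow> polyf ar A F (\<lambda>e. F f (map (\<lambda>p. p e) ps))"

locale finite_algebra =
  fixes ar :: "'f \<Rightarrow> nat" and A :: "'a set" and F :: "'f \<Rightarrow> 'a list \<Rightarrow> 'a"
  assumes algebra: "is_algebra ar A F" and finite_carrier: "finite A"
begin

abbreviation poly where "poly \<equiv> polyf ar A F"

definition pol1 :: "('a \<Rightarrow> 'a) \<Rightarrow> bool" where
  "pol1 u \<longleftrightarrow> poly (\<lambda>e. u (e 0))"

definition pol2 :: "('a \<Rightarrow> 'a \<Rightarrow> 'a) \<Rightarrow> bool" where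
  "pol2 g \<longleftrightarrow> poly (\<lambda>e. g (e 0) (e 1))"

lemma poly_closed: "poly p \<Longrightarrow> (\<And>i. e i \<in> A) \<Longrightarrow> p e \<in> A"
proof (induction rule: polyf.induct)
  case (app ps f)
  then show ?case
    using algebra unfolding is_algebra_def by (auto simp: subset_eq)
qed auto

lemma poly_subst: "poly p \<Longrightarrow> (\<And>i. poly (q i)) \<Longrightarrow> poly (\<lambda>e. p (\<lambda>i. q i e))"
proof (induction rule: polyf.induct)
  case (app ps f)
  have "poly (\<lambda>e. F f (map (\<lambda>p. p e) (map (\<lambda>p e. p (\<lambda>i. q i e)) ps)))"
    using app by (intro polyf.app) auto
  then show ?case by (simp add: comp_def)
qed (auto intro: polyf.const)

lemma pol1_poly: "pol1 u \<Longrightarrow> poly p \<Longrightarrow> poly (\<lambda>e. u (p e))"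
  using poly_subst[of "\<lambda>e. u (e 0)" "\<lambda>_. p"] unfolding pol1_def by simp

lemma pol2_poly: "pol2 g \<Longrightarrow> poly p \<Longrightarrow> poly q \<Longrightarrow> poly (\<lambda>e. g (p e) (q e))"
  using poly_subst[of "\<lambda>e. g (e 0) (e 1)" "\<lambda>i. if i = 0 then p else q"]
  unfolding pol2_def by simp

lemma pol1_id: "pol1 (\<lambda>x. x)"
  unfolding pol1_def by (rule polyf.var)

lemma pol1_const: "c \<in> A \<Longrightarrow> pol1 (\<lambda>x. c)"
  unfolding pol1_def by (rule polyf.const)

lemma pol1_comp: "pol1 u \<Longrightarrow> pol1 v \<Longrightarrow> pol1 (\<lambda>x. u (v x))"
  using pol1_poly[of u "\<lambda>e. v (e 0)"] unfolding pol1_def by simp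

lemma pol1_pol2: "pol2 g \<Longrightarrow> pol1 u \<Longrightarrow> pol1 v \<Longrightarrow> pol1 (\<lambda>x. g (u x) (v x))"
  using pol2_poly[of g "\<lambda>e. u (e 0)" "\<lambda>e. v (e 0)"] unfolding pol1_def by simp

lemma pol1_funpow: "pol1 u \<Longrightarrow> pol1 (\<lambda>x. (u ^^ n) x)"
proof (induction n)
  case (Suc n)
  then show ?case using pol1_comp[OF Suc.prems Suc.IH] by simp
qed (use pol1_id in \<open>simp add: id_def\<close>)

lemma pol1_left: "pol2 g \<Longrightarrow> c \<in> A \<Longrightarrow> pol1 (\<lambda>x. g x c)"
  by (rule pol1_pol2[OF _ pol1_id pol1_const])

lemma pol1_right: "pol2 g \<Longrightarrow> c \<in> A \<Longrightarrow> pol1 (\<lambda>y. g c y)"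
  by (rule pol1_pol2[OF _ pol1_const pol1_id])

lemma pol2_comp:
  assumes "pol2 g" "pol2 h" "pol2 k"
  shows "pol2 (\<lambda>x y. g (h x y) (k x y))"
  using pol2_poly[of g "\<lambda>e. h (e 0) (e 1)" "\<lambda>e. k (e 0) (e 1)"] assms
  unfolding pol2_def by simp

lemma pol2_fst: "pol1 u \<Longrightarrow> pol2 (\<lambda>x y. u x)"
  unfolding pol2_def using pol1_poly[OF _ polyf.var] .

lemma pol2_snd: "pol1 u \<Longrightarrow> pol2 (\<lambda>x y. u y)"
  unfolding pol2_def using pol1_poly[OF _ polyf.var] .

lemma pol2_pol1_comp: "pol2 g \<Longrightarrow> pol1 u \<Longrightarrow> pol1 v \<Longrightarrow> pol2 (\<lambda>x y. g (u x) (v y))"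
  by (rule pol2_comp[OF _ pol2_fst pol2_snd])

lemma pol1_pol2_comp: "pol1 u \<Longrightarrow> pol2 g \<Longrightarrow> pol2 (\<lambda>x y. u (g x y))"
  using pol1_poly[of u "\<lambda>e. g (e 0) (e 1)"] unfolding pol2_def by simp

lemma pol2_swap: "pol2 g \<Longrightarrow> pol2 (\<lambda>x y. g y x)"
  by (rule pol2_comp[OF _ pol2_snd[OF pol1_id] pol2_fst[OF pol1_id]])

lemma pol2_iter_left: "pol2 g \<Longrightarrow> pol2 (\<lambda>x y. ((\<lambda>x. g x y) ^^ n) x)"
proof (induction n)
  case (Suc n)
  then show ?case using pol2_comp[OF Suc.prems Suc.IH pol2_snd[OF pol1_id]] by simp
qed (simp add: pol2_fst[OF pol1_id])

lemma pol2_iter_right: "pol2 g \<Longrightarrow> pol2 (\<lambda>x y. ((\<lambda>y. g x y) ^^ n) y)"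
  using pol2_swap[OF pol2_iter_left[OF pol2_swap]] by simp

lemma pol1_closed: "pol1 u \<Longrightarrow> x \<in> A \<Longrightarrow> u x \<in> A"
  unfolding pol1_def using poly_closed[of "\<lambda>e. u (e 0)" "\<lambda>_. x"] by simp

lemma congruence_poly:
  assumes "congruence ar A F \<alpha>" "poly p" "\<And>i. (e i, e' i) \<in> \<alpha>"
  shows "(p e, p e') \<in> \<alpha>"
  using assms(2)
proof (induction rule: polyf.induct)
  case (const c)
  then show ?case using assms(1) unfolding congruence_def equiv_def refl_on_def by auto
next
  case (app ps f)
  then show ?case using assms(1) unfolding congruence_def by auto
qed (use assms(3) in auto)

lemma congruence_pol1:
  "congruence ar A F \<alpha> \<Longrightarrow> pol1 u \<Longrightarrow> (x, y) \<in> \<alpha> \<Longrightarrow> (u x, u y) \<in> \<alpha>"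
  unfolding pol1_def using congruence_poly[of \<alpha> "\<lambda>e. u (e 0)" "\<lambda>_. x" "\<lambda>_. y"] by simp

text \<open>The arguments of an operation are changed one at a time.\<close>
lemma congruence_if_pol1:
  assumes eq: "equiv A \<theta>" and cl: "\<And>u x y. pol1 u \<Longrightarrow> (x, y) \<in> \<theta> \<Longrightarrow> (u x, u y) \<in> \<theta>"
  shows "congruence ar A F \<theta>"
  unfolding congruence_def
proof (intro conjI allI impI eq, elim conjE)
  fix f and xs ys :: "'a list"
  assume len: "length xs = ar f" "length ys = ar f" and rel: "\<forall>i<ar f. (xs ! i, ys ! i) \<in> \<theta>"
  have sub: "\<theta> \<subseteq> A \<times> A" and tr: "trans \<theta>" and re: "refl_on A \<theta>"
    using eq by (auto simp: equiv_def)
  have inA: "xs ! i \<in> A" "ys ! i \<in> A" if "i < ar f" for i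
    using rel sub that by auto
  define zs where "zs j = take j ys @ drop j xs" for j
  have "(F f xs, F f (zs j)) \<in> \<theta>" if "j \<le> ar f" for j
    using that
  proof (induction j)
    case 0
    have "set xs \<subseteq> A" using inA len by (auto simp: in_set_conv_nth)
    then show ?case using re algebra len unfolding zs_def is_algebra_def refl_on_def by auto
  next
    case (Suc j)
    define ps :: "((nat \<Rightarrow> 'a) \<Rightarrow> 'a) list" where
      "ps = map (\<lambda>c e. c) (take j ys) @ [\<lambda>e. e 0] @ map (\<lambda>c e. c) (drop (Suc j) xs)"
    have "poly (\<lambda>e. F f (map (\<lambda>p. p e) ps))"
    proof (rule polyf.app)
      show "length ps = ar f" using Suc len by (auto simp: ps_def)
    next
      fix p assume "p \<in> set ps"
      moreover have "set (take j ys) \<subseteq> A" "set (drop (Suc j) xs) \<subseteq> A"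
        using inA len by (auto simp: in_set_conv_nth)
      ultimately show "poly p" by (auto simp: ps_def intro: polyf.var polyf.const)
    qed
    then have u: "pol1 (\<lambda>x. F f (take j ys @ [x] @ drop (Suc j) xs))"
      unfolding pol1_def by (simp add: ps_def comp_def)
    have e1: "take j ys @ [xs ! j] @ drop (Suc j) xs = zs j"
      using Suc len by (simp add: zs_def Cons_nth_drop_Suc)
    have e2: "take j ys @ [ys ! j] @ drop (Suc j) xs = zs (Suc j)"
      using Suc len by (simp add: zs_def take_Suc_conv_app_nth)
    have "(F f (zs j), F f (zs (Suc j))) \<in> \<theta>"
      using cl[OF u, of "xs ! j" "ys ! j"] rel Suc unfolding e1 e2 by auto
    then show ?case using Suc tr by (meson Suc_leD transD)
  qed
  from this[of "ar f"] show "(F f xs, F f ys) \<in> \<theta>" using len by (simp add: zs_def)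
qed

section \<open>Principal congruences as chains of polynomial images\<close>

definition link :: "'a \<Rightarrow> 'a \<Rightarrow> 'a rel" where
  "link a b = {(x, y). \<exists>u. pol1 u \<and> (x = u a \<and> y = u b \<or> x = u b \<and> y = u a)}"

text \<open>Maltsev's description of the principal congruence generated by \<open>(a, b)\<close>,
  for \<open>a\<close> and \<open>b\<close> in \<open>A\<close>. Compatibility comes from composing
  unary polynomials, reflexivity from the constant ones.\<close>

definition Cg :: "'a \<Rightarrow> 'a \<Rightarrow> 'a rel" where
  "Cg a b = (link a b)\<^sup>+"

lemma link_sym: "(x, y) \<in> link a b \<Longrightarrow> (y, x) \<in> link a b"
  unfolding link_def by blast

lemma link_pol1:
  assumes "pol1 v" "(x, y) \<in> link a b"
  shows "(v x, v y) \<in> link a b"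
proof -
  obtain u where "pol1 u" "x = u a \<and> y = u b \<or> x = u b \<and> y = u a"
    using assms(2) unfolding link_def by auto
  with pol1_comp[OF assms(1)] show ?thesis
    unfolding link_def by (intro CollectI case_prodI exI[of _ "\<lambda>x. v (u x)"]) auto
qed

lemma Cg_pol1:
  assumes "pol1 v" "(x, y) \<in> Cg a b"
  shows "(v x, v y) \<in> Cg a b"
  using assms(2) unfolding Cg_def
proof (induction rule: trancl_induct)
  case (base y)
  then show ?case by (rule r_into_trancl[OF link_pol1[OF assms(1)]])
next
  case (step y z)
  show ?case by (rule trancl_into_trancl[OF step.IH link_pol1[OF assms(1) step.hyps(2)]])
qed

lemma equiv_Cg:
  assumes "a \<in> A" "b \<in> A"
  shows "equiv A (Cg a b)"
proof (rule equivI)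
  have "link a b \<subseteq> A \<times> A" unfolding link_def using assms by (auto simp: pol1_closed)
  then show "Cg a b \<subseteq> A \<times> A" unfolding Cg_def by (rule trancl_subset_Sigma)
  show "refl_on A (Cg a b)"
    unfolding refl_on_def Cg_def
  proof
    fix c assume "c \<in> A"
    then have "(c, c) \<in> link a b"
      unfolding link_def by (intro CollectI case_prodI exI[of _ "\<lambda>_. c"]) (simp add: pol1_const)
    then show "(c, c) \<in> (link a b)\<^sup>+" by (rule r_into_trancl)
  qed
  show "sym (Cg a b)" unfolding Cg_def by (rule sym_trancl) (rule symI, rule link_sym)
  show "trans (Cg a b)" unfolding Cg_def by (rule trans_trancl)
qed

lemma congruence_Cg: "a \<in> A \<Longrightarrow> b \<in> A \<Longrightarrow> congruence ar A F (Cg a b)"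
proof (rule congruence_if_pol1[OF equiv_Cg])
  fix u x y assume "pol1 u" "(x, y) \<in> Cg a b"
  then show "(u x, u y) \<in> Cg a b" by (rule Cg_pol1)
qed

lemma Cg_generator: "(a, b) \<in> Cg a b"
  unfolding Cg_def link_def
  by (intro r_into_trancl CollectI case_prodI exI[of _ "\<lambda>x. x"]) (simp add: pol1_id)

lemma Cg_minimal:
  assumes "congruence ar A F \<theta>" "(a, b) \<in> \<theta>"
  shows "Cg a b \<subseteq> \<theta>"
proof -
  have tr: "trans \<theta>" and sy: "sym \<theta>" using assms(1) by (auto simp: congruence_def equiv_def)
  have "link a b \<subseteq> \<theta>"
    unfolding link_def using congruence_pol1[OF assms(1) _ assms(2)] sy by (blast dest: symD)
  then have "(link a b)\<^sup>+ \<subseteq> \<theta>\<^sup>+" by (rule trancl_mono_subset)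
  then show ?thesis unfolding Cg_def trancl_id[OF tr] .
qed

text \<open>A chain of links from \<open>c\<close> to \<open>d\<close> cannot preserve
  \<open>Q\<close> throughout, and each link is the image of \<open>{a, b}\<close> under a unary
  polynomial.\<close>

lemma Cg_separates:
  assumes "(c, d) \<in> Cg a b" "Q c" "\<not> Q d"
  shows "\<exists>u. pol1 u \<and> Q (u a) \<noteq> Q (u b)"
proof (rule ccontr)
  assume neg: "\<not> ?thesis"
  have "(c, y) \<in> (link a b)\<^sup>+ \<Longrightarrow> Q y" for y
  proof (induction rule: trancl_induct)
    case (base y)
    then show ?case using neg assms(2) unfolding link_def by blast
  next
    case (step y z)
    then show ?case using neg unfolding link_def by blast
  qed
  then show False using assms unfolding Cg_def by blast
qed

end

section \<open>Minimal sets\<close>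

lemma funpow_closed: "h ` U \<subseteq> U \<Longrightarrow> x \<in> U \<Longrightarrow> (h ^^ n) x \<in> U"
  by (induction n) auto

lemma bij_betw_funpow_self: "bij_betw h U U \<Longrightarrow> bij_betw (h ^^ n) U U"
proof (induction n)
  case 0
  then show ?case by (simp add: bij_betw_def)
next
  case (Suc n)
  then show ?case using bij_betw_trans[of "h ^^ n" U U h U] by (simp add: comp_def)
qed

text \<open>The orbit of \<open>x\<close> runs into a cycle after fewer than \<open>card U\<close>
  steps, and the length of the cycle is at most \<open>card U\<close>. The factorial is a multiple
  of this length and no smaller than the number of steps before the cycle.\<close>

lemma funpow_fact_card_idem:
  fixes h :: "'a \<Rightarrow> 'a"
  assumes "finite U" "h ` U \<subseteq> U" "x \<in> U"
  defines "K \<equiv> fact (card U)"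
  shows "(h ^^ K) ((h ^^ K) x) = (h ^^ K) x"
proof -
  have "\<not> inj_on (\<lambda>i. (h ^^ i) x) {..card U}"
  proof
    assume "inj_on (\<lambda>i. (h ^^ i) x) {..card U}"
    moreover have "(\<lambda>i. (h ^^ i) x) ` {..card U} \<subseteq> U"
      using funpow_closed[OF assms(2,3)] by auto
    ultimately have "card {..card U} \<le> card U"
      using assms(1) by (rule card_inj_on_le)
    then show False by simp
  qed
  then obtain i j where ij: "i < j" "j \<le> card U" "(h ^^ i) x = (h ^^ j) x"
    unfolding inj_on_def by (metis atMost_iff linorder_neqE_nat)
  define p where "p = j - i"
  have step: "(h ^^ (n + p)) x = (h ^^ n) x" if "i \<le> n" for n
  proof -
    have "(h ^^ (n + p)) x = (h ^^ ((n - i) + j)) x"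
      using that ij by (simp add: p_def)
    also have "\<dots> = (h ^^ (n - i)) ((h ^^ i) x)"
      using ij by (simp add: funpow_add)
    also have "\<dots> = (h ^^ n) x"
      using that by (metis comp_apply funpow_add le_add_diff_inverse2)
    finally show ?thesis .
  qed
  have per: "(h ^^ (n + m * p)) x = (h ^^ n) x" if "i \<le> n" for n m
  proof (induction m)
    case (Suc m)
    have "(h ^^ (n + Suc m * p)) x = (h ^^ ((n + m * p) + p)) x"
      by (simp add: algebra_simps)
    with step[of "n + m * p"] Suc that show ?case by simp
  qed simp
  have "p dvd K" unfolding K_def using ij by (intro dvd_fact) (auto simp: p_def)
  then obtain m where m: "K = m * p" by (metis dvdE mult.commute)
  have "i \<le> K" unfolding K_def using ij fact_ge_self[of "card U"] by linarith
  then have "(h ^^ (K + K)) x = (h ^^ K) x" using per[of K m] m by simp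
  then show ?thesis by (simp add: funpow_add)
qed

lemma trancl_first_change:
  assumes "(x, y) \<in> R\<^sup>+" "\<phi> x \<noteq> \<phi> y"
  shows "\<exists>c c'. (x, c) \<in> R\<^sup>* \<and> (c, c') \<in> R \<and> \<phi> c \<noteq> \<phi> c'"
proof (rule ccontr)
  assume neg: "\<not> ?thesis"
  have "(x, y) \<in> R\<^sup>* \<Longrightarrow> \<phi> x = \<phi> y" for y
    by (induction rule: rtrancl_induct) (use neg in auto)
  with assms show False by (simp add: trancl_into_rtrancl)
qed

lemma eval_trm_cong:
  "wf_trm ar k t \<Longrightarrow> (\<And>i. i < k \<Longrightarrow> v i = w i) \<Longrightarrow> eval_trm F v t = eval_trm F w t"
proof (induction t)
  case (App f ts)
  then have "map (eval_trm F v) ts = map (eval_trm F w) ts" by auto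
  then show ?case by (simp only: eval_trm.simps)
qed auto

text \<open>The setting of tame congruence theory. By \<open>generated\<close>, \<alpha> is an atom
  of the congruence lattice; by \<open>e_minimal\<close>, the range of the idempotent
  \<open>e\<close> is as small as possible among the unary polynomials that do not collapse
  \<alpha>; \<open>r\<close> and \<open>s\<close> are two related points of this range.\<close>

locale minimal_set = finite_algebra ar A F
  for ar :: "'f \<Rightarrow> nat" and A :: "'a set" and F :: "'f \<Rightarrow> 'a list \<Rightarrow> 'a" +
  fixes \<alpha> :: "'a rel" and e :: "'a \<Rightarrow> 'a" and r s :: 'a
  assumes cong: "congruence ar A F \<alpha>"
    and e_pol: "pol1 e"
    and e_idem: "x \<in> A \<Longrightarrow> e (e x) = e x"
    and e_minimal: "pol1 u \<Longrightarrow> (x, y) \<in> \<alpha> \<Longrightarrow> u x \<noteq> u y \<Longrightarrow> card (e ` A) \<le> card (u ` A)"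
    and rs: "(r, s) \<in> \<alpha>" "r \<noteq> s" "e r = r" "e s = s"
    and generated: "(x, y) \<in> \<alpha> \<Longrightarrow> x \<noteq> y \<Longrightarrow> \<alpha> = Cg x y"
    and separated: "(x, y) \<in> \<alpha> \<Longrightarrow> x \<noteq> y \<Longrightarrow> \<exists>u. pol1 u \<and> e (u x) \<noteq> e (u y)"

lemma (in finite_algebra) Cg_nontrivial: "a \<noteq> b \<Longrightarrow> Cg a b \<noteq> Id_on A"
  using Cg_generator[of a b] by (metis Id_on_iff)

lemma (in finite_algebra) minimal_congruence_below_Cg:
  assumes "a \<in> A" "b \<in> A" "a \<noteq> b"
  obtains \<alpha> where "congruence ar A F \<alpha>" "\<alpha> \<noteq> Id_on A" "\<alpha> \<subseteq> Cg a b"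
    "\<And>\<beta>. congruence ar A F \<beta> \<Longrightarrow> \<beta> \<noteq> Id_on A \<Longrightarrow> \<beta> \<subseteq> \<alpha> \<Longrightarrow> \<beta> = \<alpha>"
proof -
  define P where "P \<beta> \<longleftrightarrow> congruence ar A F \<beta> \<and> \<beta> \<noteq> Id_on A \<and> \<beta> \<subseteq> Cg a b" for \<beta>
  have "P (Cg a b)"
    unfolding P_def using congruence_Cg Cg_nontrivial assms by simp
  then obtain \<alpha> where \<alpha>: "P \<alpha>" and least: "\<And>\<beta>. P \<beta> \<Longrightarrow> card \<alpha> \<le> card \<beta>"
    using ex_has_least_nat[of P _ card] by blast
  have "\<alpha> \<subseteq> A \<times> A" using \<alpha> by (auto simp: P_def congruence_def equiv_def)
  then have "finite \<alpha>" using finite_carrier finite_subset by blast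
  have "\<beta> = \<alpha>" if "congruence ar A F \<beta>" "\<beta> \<noteq> Id_on A" "\<beta> \<subseteq> \<alpha>" for \<beta>
  proof -
    have "P \<beta>" using that \<alpha> by (auto simp: P_def)
    then show ?thesis using least card_seteq[OF \<open>finite \<alpha>\<close> that(3)] by blast
  qed
  then show thesis using that \<alpha> by (auto simp: P_def)
qed

text \<open>Take \<alpha> minimal below \<open>Cg a b\<close> and \<open>f\<close> with the smallest
  range among the unary polynomials moving some \<alpha>-pair. Minimality of \<alpha> yields a
  polynomial \<open>g\<close> after which \<open>f\<close> still separates a pair in its own range;
  then \<open>f\<close> after \<open>g\<close> permutes that range, and a power of it is the
  idempotent \<open>e\<close>.\<close>

lemma (in finite_algebra) minimal_set_exists:
  assumes "a \<in> A" "b \<in> A" "a \<noteq> b"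
  shows "\<exists>\<alpha> e r s. minimal_set ar A F \<alpha> e r s \<and> (r, s) \<in> Cg a b"
proof -
  obtain \<alpha> where cong: "congruence ar A F \<alpha>" and nt: "\<alpha> \<noteq> Id_on A" and sub: "\<alpha> \<subseteq> Cg a b"
    and min: "\<And>\<beta>. congruence ar A F \<beta> \<Longrightarrow> \<beta> \<noteq> Id_on A \<Longrightarrow> \<beta> \<subseteq> \<alpha> \<Longrightarrow> \<beta> = \<alpha>"
    using minimal_congruence_below_Cg[OF assms] by blast
  have eq: "\<alpha> \<subseteq> A \<times> A" "refl_on A \<alpha>" "sym \<alpha>" "trans \<alpha>"
    using cong by (auto simp: congruence_def equiv_def)
  define moves where "moves u \<longleftrightarrow> pol1 u \<and> (\<exists>x y. (x, y) \<in> \<alpha> \<and> u x \<noteq> u y)" for u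
  have "\<exists>x y. (x, y) \<in> \<alpha> \<and> x \<noteq> y"
  proof (rule ccontr)
    assume "\<not> ?thesis"
    then have "\<alpha> = Id_on A" using eq by (auto simp: refl_on_def)
    then show False using nt by simp
  qed
  then have "moves (\<lambda>x. x)" unfolding moves_def using pol1_id by blast
  then obtain f where f: "moves f" and least: "\<And>u. moves u \<Longrightarrow> card (f ` A) \<le> card (u ` A)"
    using ex_has_least_nat[of moves _ "\<lambda>u. card (u ` A)"] by blast
  have f1: "pol1 f" using f by (simp add: moves_def)
  define V where "V = f ` A"
  have finV: "finite V" using finite_carrier by (simp add: V_def)
  have VA: "V \<subseteq> A" using pol1_closed[OF f1] by (auto simp: V_def)
  \<comment> \<open>The pairs that \<open>f\<close> cannot separate even after applying a polynomial: a congruence properly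
    below \<open>\<alpha>\<close>.\<close>
  define \<beta> where "\<beta> = {(x, y) \<in> \<alpha>. \<forall>g. pol1 g \<longrightarrow> f (g x) = f (g y)}"
  have "congruence ar A F \<beta>"
  proof (rule congruence_if_pol1)
    show "equiv A \<beta>"
    proof (rule equivI)
      show "\<beta> \<subseteq> A \<times> A" using eq by (auto simp: \<beta>_def)
      show "refl_on A \<beta>" using eq by (auto simp: \<beta>_def refl_on_def)
      show "sym \<beta>" using eq unfolding \<beta>_def sym_def by auto
      show "trans \<beta>" using eq unfolding \<beta>_def trans_def by auto
    qed
    fix u x y assume u: "pol1 u" and xy: "(x, y) \<in> \<beta>"
    have "f (g (u x)) = f (g (u y))" if "pol1 g" for g
      using xy pol1_comp[OF that u] unfolding \<beta>_def by auto
    then show "(u x, u y) \<in> \<beta>"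
      using xy congruence_pol1[OF cong u] unfolding \<beta>_def by auto
  qed
  moreover have "\<beta> \<subseteq> \<alpha>" by (auto simp: \<beta>_def)
  moreover obtain x0 y0 where xy0: "(x0, y0) \<in> \<alpha>" "f x0 \<noteq> f y0"
    using f by (auto simp: moves_def)
  then have "(x0, y0) \<notin> \<beta>" using pol1_id by (auto simp: \<beta>_def)
  ultimately have "\<beta> = Id_on A" using min xy0 by blast
  then have sep: "\<exists>g. pol1 g \<and> f (g x) \<noteq> f (g y)" if "(x, y) \<in> \<alpha>" "x \<noteq> y" for x y
  proof -
    have "(x, y) \<notin> \<beta>" using \<open>\<beta> = Id_on A\<close> that by auto
    then show ?thesis using that(1) unfolding \<beta>_def by auto
  qed
  have rs: "(f x0, f y0) \<in> \<alpha>" by (rule congruence_pol1[OF cong f1 xy0(1)])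
  obtain g where g: "pol1 g" "f (g (f x0)) \<noteq> f (g (f y0))" using sep[OF rs xy0(2)] by blast
  define h where "h x = f (g x)" for x
  have h1: "pol1 h" unfolding h_def by (rule pol1_comp[OF f1 g(1)])
  have hV: "h x \<in> V" if "x \<in> A" for x
    using pol1_closed[OF g(1) that] by (auto simp: V_def h_def)
  \<comment> \<open>This composite still moves \<open>(x0, y0)\<close>, so its range is no smaller
    than \<open>V\<close>; as it lies inside \<open>V\<close>, the map \<open>h\<close> permutes
    \<open>V\<close>.\<close>
  have "moves (\<lambda>x. h (f x))"
    unfolding moves_def using pol1_comp[OF h1 f1] xy0(1) g(2) by (auto simp: h_def)
  then have "card V \<le> card (h ` V)" using least by (simp add: V_def image_image)
  moreover have "h ` V \<subseteq> V" using hV VA by auto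
  ultimately have bij: "bij_betw h V V"
    using finV by (metis bij_betw_def card_image_le card_seteq eq_card_imp_inj_on le_antisym)
  define K where "K = (fact (card V) :: nat)"
  define e where "e = h ^^ K"
  have e1: "pol1 e" unfolding e_def using pol1_funpow[OF h1] by simp
  have "inj_on e V" "e ` V = V"
    using bij_betw_funpow_self[OF bij, of K] by (auto simp: e_def bij_betw_def)
  have idV: "e x = x" if "x \<in> V" for x
  proof -
    have "e (e x) = e x" unfolding e_def K_def
      by (rule funpow_fact_card_idem[OF finV \<open>h ` V \<subseteq> V\<close> that])
    moreover have "e x \<in> V" using that \<open>e ` V = V\<close> by blast
    ultimately show ?thesis using \<open>inj_on e V\<close> that by (auto dest: inj_onD)
  qed
  \<comment> \<open>Since \<open>K\<close> is positive, the outermost factor of the iterate is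
    \<open>h\<close>, which sends all of \<open>A\<close> into \<open>V\<close>.\<close>
  have eV: "e x \<in> V" if "x \<in> A" for x
  proof -
    obtain k where k: "K = Suc k" using fact_gt_zero[of "card V"] unfolding K_def
      by (metis gr0_implies_Suc)
    have "(h ^^ k) x \<in> A" using pol1_closed[OF pol1_funpow[OF h1] that] .
    then show ?thesis using hV by (simp add: e_def k)
  qed
  have eA: "e ` A = V" using eV idV VA by force
  have fV: "f x0 \<in> V" "f y0 \<in> V" using xy0 eq by (auto simp: V_def)
  have "minimal_set ar A F \<alpha> e (f x0) (f y0)"
  proof unfold_locales
    show "card (e ` A) \<le> card (u ` A)" if "pol1 u" "(x, y) \<in> \<alpha>" "u x \<noteq> u y" for u x y
      using that least[of u] unfolding eA V_def moves_def by blast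
    show "\<alpha> = Cg x y" if "(x, y) \<in> \<alpha>" "x \<noteq> y" for x y
    proof -
      have "x \<in> A" "y \<in> A" using that eq by auto
      moreover have "Cg x y \<noteq> Id_on A" using Cg_nontrivial that by simp
      ultimately show ?thesis using min[OF congruence_Cg, of x y] Cg_minimal[OF cong that(1)] by simp
    qed
    show "\<exists>u. pol1 u \<and> e (u x) \<noteq> e (u y)" if xy: "(x, y) \<in> \<alpha>" "x \<noteq> y" for x y
    proof -
      obtain g where g: "pol1 g" "f (g x) \<noteq> f (g y)" using sep[OF xy] by blast
      have "f (g x) \<in> V" "f (g y) \<in> V"
        using pol1_closed[OF g(1)] xy eq by (auto simp: V_def)
      then show ?thesis
        using g idV by (intro exI[of _ "\<lambda>x. f (g x)"]) (simp add: pol1_comp[OF f1])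
    qed
  qed (use cong e1 idV eV rs xy0 fV in auto)
  then show ?thesis using rs sub by blast
qed

context minimal_set
begin

section \<open>Polynomials acting on a minimal set and on its trace\<close>

definition U where "U = e ` A"

text \<open>A trace, in the terminology of Hobby and McKenzie.\<close>
definition T where "T = {x \<in> U. (r, x) \<in> \<alpha>}"

text \<open>For every \<open>h :: U \<rightarrow> U\<close> the iterate \<open>h ^^ K\<close> is idempotent.\<close>
definition K :: nat where "K = fact (card U)"

lemma alpha: "\<alpha> \<subseteq> A \<times> A" "refl_on A \<alpha>" "sym \<alpha>" "trans \<alpha>"
  using cong by (auto simp: congruence_def equiv_def)

lemma finite_U: "finite U" and U_A: "U \<subseteq> A"
  using finite_carrier pol1_closed[OF e_pol] by (auto simp: U_def)

lemma e_U: "x \<in> A \<Longrightarrow> e x \<in> U" and e_id: "x \<in> U \<Longrightarrow> e x = x"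
  using e_idem by (auto simp: U_def)

lemma rs_T: "r \<in> T" "s \<in> T"
proof -
  have "r \<in> A" "s \<in> A" using rs alpha by auto
  then show "r \<in> T" "s \<in> T"
    using rs alpha e_U[of r] e_U[of s] by (auto simp: T_def refl_on_def)
qed

lemma T_U: "T \<subseteq> U"
  by (auto simp: T_def)

lemma T_related: "x \<in> T \<Longrightarrow> y \<in> T \<Longrightarrow> (x, y) \<in> \<alpha>"
  using alpha unfolding T_def by (auto dest: symD transD)

lemma related_T: "x \<in> T \<Longrightarrow> (x, y) \<in> \<alpha> \<Longrightarrow> y \<in> U \<Longrightarrow> y \<in> T"
  using alpha unfolding T_def by (auto dest: transD)

lemma K_pos: "K = Suc (K - 1)"
  by (simp add: K_def)

lemma funpow_K_idem: "u ` U \<subseteq> U \<Longrightarrow> x \<in> U \<Longrightarrow> (u ^^ K) ((u ^^ K) x) = (u ^^ K) x"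
  unfolding K_def by (rule funpow_fact_card_idem[OF finite_U])

text \<open>The iterate is injective and idempotent. Consequently \<open>u ^^ (K - 1)\<close>
  inverts \<open>u\<close> on \<open>U\<close>, and it is a polynomial whenever \<open>u\<close> is
  one.\<close>

lemma funpow_K_id:
  assumes "bij_betw u U U" "x \<in> U"
  shows "(u ^^ K) x = x"
proof -
  have b: "bij_betw (u ^^ K) U U" by (rule bij_betw_funpow_self[OF assms(1)])
  have "(u ^^ K) ((u ^^ K) x) = (u ^^ K) x"
    using assms by (intro funpow_K_idem) (auto simp: bij_betw_def)
  with b assms(2) show ?thesis
    by (metis bij_betw_def bij_betw_apply inj_onD)
qed

text \<open>After composition with \<open>e\<close>, the range of \<open>u\<close> on
  \<open>A\<close> becomes the image of \<open>U\<close> under \<open>u\<close>, and a related pair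
  is still moved, so the image cannot be smaller than \<open>U\<close>. This is the dichotomy used
  throughout: a unary polynomial preserving \<open>U\<close> either permutes \<open>U\<close> or is
  constant on the trace \<open>T\<close>.\<close>

lemma bij_if_moves:
  assumes "pol1 u" "u ` U \<subseteq> U" "(x, y) \<in> \<alpha>" "x \<in> U" "y \<in> U" "u x \<noteq> u y"
  shows "bij_betw u U U"
proof -
  have "card (e ` A) \<le> card ((\<lambda>x. u (e x)) ` A)"
    by (rule e_minimal[OF pol1_comp[OF assms(1) e_pol] assms(3)]) (use assms e_id in auto)
  then have "card U \<le> card (u ` U)" by (simp add: U_def image_image)
  then show ?thesis using finite_U assms(2)
    by (metis bij_betw_def card_image_le card_seteq eq_card_imp_inj_on le_antisym)
qed

lemma bij_if_moves_T:
  assumes "pol1 u" "u ` U \<subseteq> U" "x \<in> T" "y \<in> T" "u x \<noteq> u y"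
  shows "bij_betw u U U"
  using bij_if_moves[OF assms(1,2) T_related[OF assms(3,4)]] assms T_U by auto

text \<open>Each link is a polynomial image of \<open>{r, s}\<close>. Substituting the two
  polynomials for variables \<open>i\<close> and \<open>j\<close> and freezing the others gives a
  binary polynomial into \<open>U\<close>, to which \<open>ess\<close> applies.\<close>

lemma binary_box:
  assumes ess: "\<forall>f. pol2 f \<longrightarrow> (\<forall>x\<in>A. \<forall>y\<in>A. f x y \<in> U)
      \<longrightarrow> (f r r = f s r \<and> f r s = f s s) \<or> (f r r = f r s \<and> f s r = f s s)"
    and t: "poly t" and w: "\<forall>k. w k \<in> A" and ij: "i \<noteq> j"
    and c: "(c, c') \<in> link r s" and d: "(d, d') \<in> link r s"
  defines "\<tau> \<equiv> \<lambda>x y. e (t (w(j := y, i := x)))"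
  shows "(\<tau> c d = \<tau> c' d \<and> \<tau> c d' = \<tau> c' d') \<or> (\<tau> c d = \<tau> c d' \<and> \<tau> c' d = \<tau> c' d')"
proof -
  obtain p where p: "pol1 p" "c = p r \<and> c' = p s \<or> c = p s \<and> c' = p r"
    using c unfolding link_def by auto
  obtain q where q: "pol1 q" "d = q r \<and> d' = q s \<or> d = q s \<and> d' = q r"
    using d unfolding link_def by auto
  define f where "f x y = \<tau> (p x) (q y)" for x y
  define \<sigma> where "\<sigma> k = (if k = i then (\<lambda>v. p (v 0)) else if k = j then (\<lambda>v. q (v 1))
     else (\<lambda>v :: nat \<Rightarrow> 'a. w k))" for k
  have "poly (\<sigma> k)" for k
    using pol1_poly[OF p(1) polyf.var] pol1_poly[OF q(1) polyf.var] w
    by (auto simp: \<sigma>_def intro: polyf.const)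
  from pol1_poly[OF e_pol poly_subst[OF t this]]
  have "poly (\<lambda>v. e (t (\<lambda>k. \<sigma> k v)))" .
  moreover have "(\<lambda>k. \<sigma> k v) = w(j := q (v 1), i := p (v 0))" for v
    using ij by (auto simp: \<sigma>_def)
  ultimately have "pol2 f" unfolding pol2_def f_def \<tau>_def by simp
  moreover have "f x y \<in> U" if "x \<in> A" "y \<in> A" for x y
    unfolding f_def \<tau>_def
    by (intro e_U poly_closed[OF t]) (use w pol1_closed p(1) q(1) that in auto)
  ultimately have "(f r r = f s r \<and> f r s = f s s) \<or> (f r r = f r s \<and> f s r = f s s)"
    using ess by blast
  then show ?thesis using p(2) q(2) unfolding f_def by (elim disjE conjE) simp_all
qed

text \<open>Two elements of an \<open>\<alpha>\<close>-class are joined by a chain of pairs \<open>{p r, p s}\<close>, so a polynomial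
  that depends on its variable 0 along one such pair, and whose binary restrictions to such pairs
  depend on at most one variable, cannot depend on any other variable in the whole class.\<close>
lemma strongly_abelian_if_unary:
  assumes ess: "\<forall>f. pol2 f \<longrightarrow> (\<forall>x\<in>A. \<forall>y\<in>A. f x y \<in> U)
      \<longrightarrow> (f r r = f s r \<and> f r s = f s s) \<or> (f r r = f r s \<and> f s r = f s s)"
  shows "strongly_abelian ar A F \<alpha>"
  unfolding strongly_abelian_def
proof (intro allI impI, elim conjE, rule ccontr)
  fix k :: nat and t :: "'f trm" and x y z :: "nat \<Rightarrow> 'a"
  assume k: "1 \<le> k" and wf: "wf_trm ar k t"
    and inA: "\<forall>i<k. x i \<in> A \<and> y i \<in> A \<and> z i \<in> A"
    and xy: "\<forall>i<k. (x i, y i) \<in> \<alpha>" and yz: "\<forall>i. 1 \<le> i \<and> i < k \<longrightarrow> (y i, z i) \<in> \<alpha>"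
    and eq: "eval_trm F x t = eval_trm F y t"
    and neq: "eval_trm F (z(0 := x 0)) t \<noteq> eval_trm F (z(0 := y 0)) t"
  have linkA: "link r s \<subseteq> A \<times> A"
    using rs alpha pol1_closed by (auto simp: link_def)
  have tpoly: "poly (\<lambda>v. eval_trm F v t)"
    using wf
  proof (induction t)
    case (Var i)
    then show ?case by (simp add: polyf.var)
  next
    case (App f ts)
    have "poly (\<lambda>v. F f (map (\<lambda>p. p v) (map (\<lambda>t v. eval_trm F v t) ts)))"
      using App by (intro polyf.app) auto
    then show ?case by (simp add: comp_def)
  qed
  \<comment> \<open>Outside the variables of \<open>t\<close> the value \<open>x 0\<close> is a
    default that keeps the whole assignment in \<open>A\<close>.\<close>
  define w where "w i = (if i < k then z i else x 0)" for i
  have wA: "w i \<in> A" for i using inA k by (auto simp: w_def)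
  have val: "eval_trm F (w(0 := a)) t = eval_trm F (z(0 := a)) t" for a
    using wf by (rule eval_trm_cong) (auto simp: w_def)
  have xy0: "(x 0, y 0) \<in> \<alpha>" using xy k by auto
  then have "(eval_trm F (w(0 := x 0)) t, eval_trm F (w(0 := y 0)) t) \<in> \<alpha>"
    using alpha wA by (intro congruence_poly[OF cong tpoly]) (auto simp: refl_on_def)
  then obtain u where u: "pol1 u"
    and ne: "e (u (eval_trm F (w(0 := x 0)) t)) \<noteq> e (u (eval_trm F (w(0 := y 0)) t))"
    using separated neq val by metis
  define g where "g v = u (eval_trm F v t)" for v
  have g: "poly g" unfolding g_def by (rule pol1_poly[OF u tpoly])
  have "(x 0, y 0) \<in> (link r s)\<^sup>+" using xy0 generated[OF rs(1,2)] by (simp add: Cg_def)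
  from trancl_first_change[OF this, of "\<lambda>a. e (g (w(0 := a)))"] ne
  obtain c c' where c: "(x 0, c) \<in> (link r s)\<^sup>*" "(c, c') \<in> link r s"
    "e (g (w(0 := c))) \<noteq> e (g (w(0 := c')))"
    by (auto simp: g_def)
  \<comment> \<open>Variable 0 is kept apart: \<open>R\<close> walks through the remaining
    coordinates one link at a time, so that each step together with a link in variable 0 forms a box
    for \<open>binary_box\<close>.\<close>
  define R :: "(nat \<Rightarrow> 'a) rel" where "R = {(v, v'). (\<forall>i. v i \<in> A) \<and>
    (\<exists>j d'. j \<noteq> 0 \<and> (v j, d') \<in> link r s \<and> v' = v(j := d'))}"
  have stepR: "\<exists>j d. j \<noteq> 0 \<and> (v j, d) \<in> link r s \<and> v' = v(j := d) \<and> (\<forall>i. v i \<in> A)"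
    if "(v, v') \<in> R" for v v'
    using that unfolding R_def by blast
  have box: "(e (g (v(0 := a))) = e (g (v(0 := a'))) \<and> e (g (v'(0 := a))) = e (g (v'(0 := a')))) \<or>
      (e (g (v(0 := a))) = e (g (v'(0 := a))) \<and> e (g (v(0 := a'))) = e (g (v'(0 := a'))))"
    if vv: "(v, v') \<in> R" and a: "(a, a') \<in> link r s" for v v' a a'
  proof -
    obtain j d where j: "j \<noteq> 0" "(v j, d) \<in> link r s" "v' = v(j := d)" and vA: "\<forall>i. v i \<in> A"
      using stepR[OF vv] by blast
    show ?thesis
      using binary_box[OF ess g vA j(1)[symmetric] a j(2)] unfolding j(3) fun_upd_triv by blast
  qed
  define indep where "indep a \<longleftrightarrow> (\<forall>v. (w, v) \<in> R\<^sup>* \<longrightarrow> e (g (v(0 := a))) = e (g (w(0 := a))))" for a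
  \<comment> \<open>The values at \<open>c\<close> and \<open>c'\<close> differ at \<open>w\<close>.
    In each box this rules out the alternative of not depending on variable 0, so the step leaves
    both values unchanged and the difference survives.\<close>
  have "e (g (v(0 := c))) = e (g (w(0 := c))) \<and> e (g (v(0 := c'))) = e (g (w(0 := c')))"
    if "(w, v) \<in> R\<^sup>*" for v
    using that
  proof (induction rule: rtrancl_induct)
    case (step v v')
    show ?case using box[OF step.hyps(2) c(2)] step.IH c(3) by metis
  qed simp
  then have indep_c: "indep c" unfolding indep_def by blast
  \<comment> \<open>If the box does not depend on variable 0, the values at \<open>a'\<close> equal
    those at \<open>a\<close>, which are known not to change; otherwise the box says directly that
    the step changes nothing.\<close>
  have indep_step: "indep a'" if ind: "indep a" and lnk: "(a, a') \<in> link r s" for a a'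
    unfolding indep_def
  proof (intro allI impI)
    fix v assume "(w, v) \<in> R\<^sup>*"
    then show "e (g (v(0 := a'))) = e (g (w(0 := a')))"
    proof (induction rule: rtrancl_induct)
      case (step v v')
      have "e (g (v(0 := a))) = e (g (v'(0 := a)))"
        using ind step.hyps unfolding indep_def by (metis rtrancl.rtrancl_into_rtrancl)
      then show ?case
        using box[OF step.hyps(2) lnk] step.IH by metis
    qed simp
  qed
  have indep_all: "indep b" if "(a, b) \<in> (link r s)\<^sup>*" "indep a" for a b
    using that by (induction rule: rtrancl_induct) (auto intro: indep_step)
  have "(c, x 0) \<in> (link r s)\<^sup>*"
    using c(1) link_sym by (meson sym_rtrancl symD symI)
  then have ind_x: "indep (x 0)" using indep_all indep_c by blast
  then have ind_y: "indep (y 0)"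
    using indep_all[of "x 0" "y 0"] \<open>(x 0, y 0) \<in> (link r s)\<^sup>+\<close> by (simp add: trancl_into_rtrancl)
  have coord: "(v, v(j := d)) \<in> R\<^sup>*" if "(v j, d) \<in> (link r s)\<^sup>+" "j \<noteq> 0" "\<And>i. v i \<in> A" for v j d
    using that(1)
  proof (induction rule: trancl_induct)
    case (base d)
    then have "(v, v(j := d)) \<in> R" using that(2,3) unfolding R_def by auto
    then show ?case by (rule r_into_rtrancl)
  next
    case (step d d')
    have "d \<in> A" using step.hyps(2) linkA by auto
    then have "(v(j := d), (v(j := d))(j := d')) \<in> R"
      using that(2,3) step.hyps(2) unfolding R_def by auto
    then have "(v(j := d), v(j := d')) \<in> R" unfolding fun_upd_upd .
    with step.IH show ?case by (rule rtrancl_into_rtrancl)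
  qed
  have reach: "(w, \<lambda>i. if 1 \<le> i \<and> i < n then v i else w i) \<in> R\<^sup>*"
    if v: "\<And>i. 1 \<le> i \<Longrightarrow> i < k \<Longrightarrow> (w i, v i) \<in> \<alpha>" and "n \<le> k" for v n
    using that(2)
  proof (induction n)
    case (Suc n)
    let ?v = "\<lambda>n i. if 1 \<le> i \<and> i < n then v i else w i"
    show ?case
    proof (cases "n = 0")
      case False
      have "(?v n n, v n) \<in> (link r s)\<^sup>+"
        using v[of n] False Suc.prems generated[OF rs(1,2)] by (simp add: Cg_def)
      moreover have "?v n i \<in> A" for i using v[of i] alpha wA Suc.prems by auto
      ultimately have "(?v n, (?v n)(n := v n)) \<in> R\<^sup>*" using coord[of "?v n" n] False by blast
      moreover have "(?v n)(n := v n) = ?v (Suc n)" using False by auto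
      ultimately show ?thesis using Suc by (metis (no_types, lifting) Suc_leD rtrancl_trans)
    next
      case True
      then have "?v (Suc n) = w" by auto
      then show ?thesis by simp
    qed
  qed simp
  have tail: "e (g (w(0 := v 0))) = e (g v)"
    if v: "\<And>i. 1 \<le> i \<Longrightarrow> i < k \<Longrightarrow> (w i, v i) \<in> \<alpha>" and ind: "indep (v 0)" for v
  proof -
    let ?v = "\<lambda>i. if 1 \<le> i \<and> i < k then v i else w i"
    have "(w, ?v) \<in> R\<^sup>*" using reach[OF v] by simp
    then have "e (g (w(0 := v 0))) = e (g (?v(0 := v 0)))" using ind unfolding indep_def by metis
    moreover have "eval_trm F (?v(0 := v 0)) t = eval_trm F v t"
      using wf by (rule eval_trm_cong) auto
    ultimately show ?thesis unfolding g_def by metis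
  qed
  \<comment> \<open>Both \<open>x\<close> and \<open>y\<close> can be reached from \<open>w\<close>
    in the coordinates other than 0. Equality of \<open>t\<close> at \<open>x\<close> and
    \<open>y\<close> therefore transfers to the assignments built from \<open>w\<close>, against the
    choice of \<open>u\<close>.\<close>
  have "(w i, y i) \<in> \<alpha>" "(w i, x i) \<in> \<alpha>" if "1 \<le> i" "i < k" for i
    using that xy yz alpha unfolding w_def by (auto dest: symD transD)
  then have "e (g x) = e (g (w(0 := x 0)))" "e (g y) = e (g (w(0 := y 0)))"
    using tail[of x] tail[of y] ind_x ind_y by metis+
  then show False using ne eq unfolding g_def by metis
qed

end

section \<open>Splitting polynomials\<close>

text \<open>Here \<open>None\<close> is a neutral value: \<open>f _ b\<close> has to change \<open>\<kappa>\<close> (first alternative) only where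
  \<open>\<kappa>\<close> is not neutral, and \<open>f _ a\<close> may make it neutral everywhere (second alternative). In a group
  \<open>f x y = x + (y - a)\<close> is of the first kind; in a semilattice \<open>f = inf\<close> is of the first or of the
  second kind, depending on which of \<open>a\<close>, \<open>b\<close> is the top element.\<close>
definition (in finite_algebra) splits :: "('a \<Rightarrow> 'a option) \<Rightarrow> 'a \<Rightarrow> 'a \<Rightarrow> bool" where
  "splits \<kappa> a b \<longleftrightarrow> (\<exists>c\<in>A. \<exists>c'\<in>A. \<kappa> c \<noteq> \<kappa> c') \<and> (\<exists>f. pol2 f \<and>
     ((\<forall>x\<in>A. \<kappa> (f x a) = \<kappa> x \<and> (\<kappa> x \<noteq> None \<longrightarrow> \<kappa> (f x b) \<noteq> \<kappa> x)) \<or>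
      (\<forall>x\<in>A. \<kappa> (f x b) = \<kappa> x \<and> \<kappa> (f x a) = None)))"

section \<open>From binary polynomials on a minimal set to splitting\<close>

context minimal_set
begin

definition pol2_U :: "('a \<Rightarrow> 'a \<Rightarrow> 'a) \<Rightarrow> bool" where
  "pol2_U f \<longleftrightarrow> pol2 f \<and> (\<forall>x\<in>A. \<forall>y\<in>A. f x y \<in> U)"

lemma pol2_U_left: "pol2_U f \<Longrightarrow> y \<in> U \<Longrightarrow> pol1 (\<lambda>x. f x y) \<and> (\<lambda>x. f x y) ` U \<subseteq> U"
  using U_A unfolding pol2_U_def by (auto simp: pol1_left)

lemma pol2_U_right: "pol2_U f \<Longrightarrow> x \<in> U \<Longrightarrow> pol1 (f x) \<and> f x ` U \<subseteq> U"
  using pol1_right[of f x] U_A unfolding pol2_U_def by (auto simp: subset_iff)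

lemma pol2_U_swap: "pol2_U f \<Longrightarrow> pol2_U (\<lambda>x y. f y x)"
  unfolding pol2_U_def using pol2_swap by blast

lemma U_fun: "pol2_U f \<Longrightarrow> x \<in> U \<Longrightarrow> y \<in> U \<Longrightarrow> f x y \<in> U"
  using U_A unfolding pol2_U_def by auto

lemma pol2_U_iter_right:
  assumes "pol2_U f"
  shows "pol2_U (\<lambda>x y. ((\<lambda>y. f x y) ^^ K) y)"
  unfolding pol2_U_def
proof (intro conjI ballI)
  have f: "pol2 f" "\<And>x y. x \<in> A \<Longrightarrow> y \<in> A \<Longrightarrow> f x y \<in> U" using assms by (auto simp: pol2_U_def)
  show "pol2 (\<lambda>x y. ((\<lambda>y. f x y) ^^ K) y)" by (rule pol2_iter_right[OF f(1)])
  fix x y assume "x \<in> A" "y \<in> A"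
  then have "((\<lambda>y. f x y) ^^ (K - 1)) y \<in> A"
    by (intro funpow_closed) (use f(2) U_A in auto)
  then show "((\<lambda>y. f x y) ^^ K) y \<in> U"
    using f(2)[OF \<open>x \<in> A\<close>] by (subst K_pos) simp
qed

lemma pol2_U_iter_left: "pol2_U f \<Longrightarrow> pol2_U (\<lambda>x y. ((\<lambda>x. f x y) ^^ K) x)"
  using pol2_U_swap[OF pol2_U_iter_right[OF pol2_U_swap]] .

text \<open>Composing with \<open>e\<close> reduces everything to \<open>U\<close>, and composing
  the second argument with \<open>p\<close> allows the control values \<open>a\<close> and
  \<open>b\<close> to be replaced by their images in \<open>U\<close>.\<close>

lemma splitsI:
  assumes f: "pol2_U f" and p: "pol1 p" and ab: "a \<in> A" "b \<in> A"
    and nc: "c \<in> U" "c' \<in> U" "\<kappa> c \<noteq> (\<kappa> c' :: 'a option)"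
    and act: "(\<forall>x\<in>U. \<kappa> (f x (e (p a))) = \<kappa> x \<and> (\<kappa> x \<noteq> None \<longrightarrow> \<kappa> (f x (e (p b))) \<noteq> \<kappa> x)) \<or>
      (\<forall>x\<in>U. \<kappa> (f x (e (p b))) = \<kappa> x \<and> \<kappa> (f x (e (p a))) = None)"
  shows "\<exists>\<kappa>. splits \<kappa> a b"
  unfolding splits_def
proof (intro exI[of _ "\<lambda>x. \<kappa> (e x)"] exI[of _ "\<lambda>x y. f (e x) (e (p y))"] conjI)
  show "pol2 (\<lambda>x y. f (e x) (e (p y)))"
    using pol2_pol1_comp[OF _ e_pol pol1_comp[OF e_pol p]] f unfolding pol2_U_def by blast
  show "\<exists>c\<in>A. \<exists>c'\<in>A. \<kappa> (e c) \<noteq> \<kappa> (e c')" using nc e_id U_A by (metis subsetD)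
  have "e (f (e x) (e (p y))) = f (e x) (e (p y))" if "x \<in> A" "y \<in> A" for x y
    using that by (intro e_id U_fun[OF f] e_U pol1_closed[OF p])
  then show "(\<forall>x\<in>A. \<kappa> (e (f (e x) (e (p a)))) = \<kappa> (e x) \<and>
      (\<kappa> (e x) \<noteq> None \<longrightarrow> \<kappa> (e (f (e x) (e (p b)))) \<noteq> \<kappa> (e x))) \<or>
    (\<forall>x\<in>A. \<kappa> (e (f (e x) (e (p b)))) = \<kappa> (e x) \<and> \<kappa> (e (f (e x) (e (p a)))) = None)"
    using act ab e_U by (elim disjE) (rule disjI1, simp, rule disjI2, simp)
qed

text \<open>Here \<kappa> records only membership in \<open>C\<close>, with \<open>None\<close>
  outside. The control value \<open>o1\<close> keeps every point and \<open>z\<close> expels it from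
  \<open>C\<close>; which of \<open>a\<close> and \<open>b\<close> yields \<open>o1\<close> decides
  between the two alternatives of \<open>splits\<close>.\<close>

lemma absorbing_splits:
  assumes f: "pol2_U f" and p: "pol1 p" and ab: "a \<in> A" "b \<in> A"
    and C: "c \<in> U \<inter> C" "c' \<in> U - C"
    and pab: "e (p a) = o1 \<and> e (p b) = z \<or> e (p b) = o1 \<and> e (p a) = z"
    and keep: "\<And>x. x \<in> U \<Longrightarrow> f x o1 = x" and leave: "\<And>x. x \<in> U \<Longrightarrow> f x z \<notin> C"
  shows "\<exists>\<kappa>. splits \<kappa> a b"
proof (rule splitsI[OF f p ab, of c c' "\<lambda>x. if x \<in> C then Some c else None"])
  let ?\<kappa> = "\<lambda>x. if x \<in> C then Some c else None"
  show "c \<in> U" "c' \<in> U" "?\<kappa> c \<noteq> ?\<kappa> c'" using C by auto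
  show "(\<forall>x\<in>U. ?\<kappa> (f x (e (p a))) = ?\<kappa> x \<and> (?\<kappa> x \<noteq> None \<longrightarrow> ?\<kappa> (f x (e (p b))) \<noteq> ?\<kappa> x)) \<or>
      (\<forall>x\<in>U. ?\<kappa> (f x (e (p b))) = ?\<kappa> x \<and> ?\<kappa> (f x (e (p a))) = None)"
    using pab keep leave by auto
qed

text \<open>Since \<open>(r, s)\<close> generates \<alpha>, all of \<alpha> lies in
  \<open>Cg a b\<close>, and a chain of links from \<open>c\<close> to \<open>d\<close> must leave
  the fibre of \<open>e\<close> over \<open>c\<close>.\<close>

lemma separating_pol1:
  assumes "(r, s) \<in> Cg a b" "a \<in> A" "b \<in> A" "(c, d) \<in> \<alpha>" "c \<in> U" "d \<in> U" "c \<noteq> d"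
  shows "\<exists>p z. pol1 p \<and> z \<in> U \<and> z \<noteq> c \<and>
    (e (p a) = c \<and> e (p b) = z \<or> e (p b) = c \<and> e (p a) = z)"
proof -
  have "\<alpha> \<subseteq> Cg a b"
    using Cg_minimal[OF congruence_Cg[OF assms(2,3)] assms(1)] generated[OF rs(1,2)] by simp
  then have "(c, d) \<in> Cg a b" using assms(4) by blast
  from Cg_separates[OF this, of "\<lambda>x. e x = c"]
  obtain p where p: "pol1 p" "(e (p a) = c) \<noteq> (e (p b) = c)"
    using assms e_id by metis
  moreover have "e (p a) \<in> U" "e (p b) \<in> U" using p pol1_closed assms e_U by auto
  ultimately show ?thesis by metis
qed

text \<open>Iteration in the first argument turns \<open>i\<close> into a right unit of
  \<open>g\<close> on \<open>U\<close> and makes the map at \<open>z\<close> idempotent. If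
  \<open>g x z = i\<close>, then \<open>g i z = i = g i i\<close>, contradicting injectivity of
  \<open>g i\<close>. So \<open>absorbing_splits\<close> applies with
  \<open>C = {i}\<close>.\<close>

lemma meet_splits:
  assumes f: "pol2_U f" and t: "i \<in> T" "j \<in> T" "i \<noteq> j"
    and meet: "f i i = i" "f i j = j" "f j i = j" "f j j = j"
    and ab: "(r, s) \<in> Cg a b" "a \<in> A" "b \<in> A"
  shows "\<exists>\<kappa>. splits \<kappa> a b"
proof -
  have tU: "i \<in> U" "j \<in> U" using t T_U by auto
  obtain p z where p: "pol1 p" and z: "z \<in> U" "z \<noteq> i"
    and pab: "e (p a) = i \<and> e (p b) = z \<or> e (p b) = i \<and> e (p a) = z"
    using separating_pol1[OF ab T_related[OF t(1,2)] tU t(3)] by blast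
  define g where "g x y = ((\<lambda>x. f x y) ^^ K) x" for x y
  have g: "pol2_U g" unfolding g_def by (rule pol2_U_iter_left[OF f])
  have "bij_betw (\<lambda>x. f x i) U U"
    using pol2_U_left[OF f tU(1)] t meet by (intro bij_if_moves_T[of _ i j]) auto
  then have keep: "g x i = x" if "x \<in> U" for x
    unfolding g_def using funpow_K_id that by blast
  have "((\<lambda>x. f x j) ^^ Suc n) i = j" for n
    by (induction n) (auto simp: meet)
  then have "g i j = j" unfolding g_def by (subst K_pos)
  then have bij: "bij_betw (g i) U U"
    using pol2_U_right[OF g tU(1)] t keep[OF tU(1)] by (intro bij_if_moves_T[of _ i j]) auto
  have leave: "g x z \<noteq> i" if x: "x \<in> U" for x
  proof
    assume gx: "g x z = i"
    have "g (g x z) z = g x z"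
      unfolding g_def using pol2_U_left[OF f z(1)] x by (intro funpow_K_idem) auto
    then have "g i z = g i i" using gx keep[OF tU(1)] by simp
    then show False using bij z tU by (auto simp: bij_betw_def dest: inj_onD)
  qed
  show ?thesis
    by (rule absorbing_splits[OF g p ab(2,3), of i "{i}" j i z]) (use tU t keep leave pab in auto)
qed

text \<open>The nonabelian case: a polynomial that is a permutation in one position and collapses in another
  forces \<open>T\<close> to have two elements and induces a semilattice operation on it.\<close>
lemma meet_if_mixed:
  assumes f0: "pol2_U f0" and x: "x1 \<in> T" "x2 \<in> T"
    and bij: "bij_betw (f0 x1) U U" and nbij: "\<not> bij_betw (f0 x2) U U"
  shows "\<exists>f i j. pol2_U f \<and> i \<in> T \<and> j \<in> T \<and> i \<noteq> j \<and>
    f i i = i \<and> f i j = j \<and> f j i = j \<and> f j j = j"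
proof -
  \<comment> \<open>The iteration makes row \<open>x1\<close> the identity on \<open>U\<close>,
    while row \<open>x2\<close> remains constant on \<open>T\<close>, with value
    \<open>c\<close>.\<close>
  define f where "f x y = ((\<lambda>y. f0 x y) ^^ K) y" for x y
  have f: "pol2_U f" unfolding f_def by (rule pol2_U_iter_right[OF f0])
  have xU: "x1 \<in> U" "x2 \<in> U" using x T_U by auto
  have id: "f u y = y" if "bij_betw (f0 u) U U" "y \<in> U" for u y
    unfolding f_def using funpow_K_id[OF that] by simp
  have collapse: "f u y = f u y'" if "\<not> bij_betw (f0 u) U U" "u \<in> U" "y \<in> T" "y' \<in> T" for u y y'
  proof -
    have "f0 u y = f0 u y'"
      using that bij_if_moves_T[of "f0 u" y y'] pol2_U_right[OF f0] by blast
    moreover have "f u v = ((\<lambda>y. f0 u y) ^^ (K - 1)) (f0 u v)" for v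
      unfolding f_def by (subst K_pos) (simp add: funpow_swap1)
    ultimately show ?thesis by simp
  qed
  have fT: "f u y \<in> T" if "u \<in> T" "y \<in> T" for u y
  proof (rule related_T[of y])
    have "(f x1 y, f u y) \<in> \<alpha>"
      using congruence_pol1[OF cong _ T_related[OF x(1) that(1)], of "\<lambda>u. f u y"]
        pol2_U_left[OF f] that T_U by blast
    then show "(y, f u y) \<in> \<alpha>" using id[OF bij] that T_U by auto
    show "f u y \<in> U" using U_fun[OF f] that T_U by blast
  qed (use that in auto)
  define c where "c = f x2 r"
  have c: "c \<in> T" unfolding c_def by (rule fT[OF x(2) rs_T(1)])
  have x2c: "f x2 y = c" if "y \<in> T" for y
    unfolding c_def by (rule collapse[OF nbij xU(2) that rs_T(1)])
  have ne: "x1 \<noteq> x2" using bij nbij by auto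
  have bijl: "bij_betw (\<lambda>u. f u v) U U" if v: "v \<in> T" "v \<noteq> c" for v
  proof (rule bij_if_moves_T[of _ x1 x2])
    show "f x1 v \<noteq> f x2 v" using id[OF bij] x2c v T_U by auto
  qed (use pol2_U_left[OF f] v T_U x in auto)
  have eqI: "u = u'" if "v \<in> T" "v \<noteq> c" "u \<in> U" "u' \<in> U" "f u v = f u' v" for u u' v
    using bijl[OF that(1,2)] that(3-5) by (auto simp: bij_betw_def dest: inj_onD)
  have notinj: "\<not> bij_betw (\<lambda>u. f u c) U U"
  proof
    assume "bij_betw (\<lambda>u. f u c) U U"
    moreover have "f x1 c = f x2 c" using id[OF bij] x2c c T_U by auto
    ultimately show False using ne xU by (auto simp: bij_betw_def dest: inj_onD)
  qed
  \<comment> \<open>Row \<open>x2\<close> also takes the value \<open>c\<close> at \<open>c\<close>,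
    so any other value would make column \<open>c\<close> a permutation; but that column identifies
    \<open>x1\<close> and \<open>x2\<close>.\<close>
  have c_absorbs: "f u c = c" if "u \<in> T" for u
  proof (rule ccontr)
    assume "f u c \<noteq> c"
    then have "bij_betw (\<lambda>u. f u c) U U"
      using pol2_U_left[OF f] c T_U that x x2c[OF c]
      by (intro bij_if_moves_T[of _ u x2]) auto
    then show False using notinj by simp
  qed
  obtain v where v: "v \<in> T" "v \<noteq> c" using rs_T rs(2) by metis
  \<comment> \<open>Column \<open>v\<close> is injective, and for \<open>u\<close> in
    \<open>T\<close> it takes only the values it has at \<open>x1\<close> and at \<open>x2\<close>,
    according to whether row \<open>u\<close> of \<open>f0\<close> permutes
    \<open>U\<close>.\<close>
  have T2: "u = x1 \<or> u = x2" if u: "u \<in> T" for u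
  proof (cases "bij_betw (f0 u) U U")
    case True
    then have "f u v = f x1 v" using id bij v T_U by auto
    then show ?thesis using eqI[OF v] u xU T_U by blast
  next
    case False
    then have "f u v = f u c" using collapse[of u v c] u v c T_U by auto
    then have "f u v = f x2 v" using c_absorbs[OF u] x2c v by simp
    then show ?thesis using eqI[OF v] u xU T_U by blast
  qed
  have x1id: "f x1 x1 = x1" "f x1 x2 = x2" using id[OF bij] xU by auto
  show ?thesis
  proof (cases "c = x2")
    case True
    then show ?thesis
      using f x ne x1id x2c[OF x(1)] x2c[OF x(2)]
      by (intro exI[of _ f] exI[of _ x1] exI[of _ x2]) auto
  next
    case False
    then have cx: "c = x1" using T2[OF c] by simp
    \<comment> \<open>With \<open>x1\<close> as true and \<open>x2\<close> as false,
      \<open>f\<close> is implication on \<open>T\<close>. Then \<open>f u x2\<close> is negation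
      and \<open>g\<close> is disjunction, a semilattice operation with neutral element
      \<open>x2\<close>.\<close>
    define g where "g u w = f (f u x2) w" for u w
    have "pol2 g"
      using pol2_pol1_comp[of f "\<lambda>u. f u x2" "\<lambda>x. x"] f pol2_U_left[OF f xU(2)] pol1_id
      unfolding g_def pol2_U_def by simp
    then have "pol2_U g" using f xU U_A unfolding g_def pol2_U_def by (meson subsetD)
    moreover have "f x2 x2 = x1" "f x2 x1 = x1" using x2c x cx by auto
    ultimately show ?thesis
      using x ne x1id by (intro exI[of _ g] exI[of _ x2] exI[of _ x1]) (auto simp: g_def)
  qed
qed

text \<open>The abelian case: \<open>f\<close> plays the role of addition with neutral element \<open>r\<close>.\<close>
lemma bij_control_splits:
  assumes f: "pol2_U f" and unit: "\<And>x. x \<in> U \<Longrightarrow> f x r = x"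
    and bijT: "\<And>x. x \<in> T \<Longrightarrow> bij_betw (f x) U U"
    and z: "z \<in> U" "z \<noteq> r" and bij: "bij_betw (\<lambda>x. f x z) U U"
    and p: "pol1 p" and ab: "a \<in> A" "b \<in> A"
    and pab: "e (p a) = r \<and> e (p b) = z \<or> e (p b) = r \<and> e (p a) = z"
  shows "\<exists>\<kappa>. splits \<kappa> a b"
proof -
  let ?\<kappa> = "\<lambda>x. if x \<in> T then Some x else None"
  have rU: "r \<in> U" "s \<in> U" using rs_T T_U by auto
  have nofix: "f x z \<noteq> x" if "x \<in> T" for x
    using inj_onD[OF bij_betw_imp_inj_on[OF bijT[OF that]], of z r] unit[of x] that z rU T_U by auto
  show ?thesis
    using pab
  proof
    assume "e (p a) = r \<and> e (p b) = z"
    then show ?thesis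
      using rs rs_T rU unit nofix
      by (intro splitsI[OF f p ab, of r s ?\<kappa>]) (auto split: if_splits)
  next
    assume pz: "e (p b) = r \<and> e (p a) = z"
    define h where "h = (\<lambda>x. f x z)"
    have hU: "h ` U \<subseteq> U" "pol1 h" using pol2_U_left[OF f z(1)] by (auto simp: h_def)
    \<comment> \<open>The map \<open>k\<close> inverts \<open>h\<close> on \<open>U\<close>.
      Shifting the first argument by it makes \<open>z\<close> the neutral control value instead of
      \<open>r\<close>, which exchanges the roles of \<open>a\<close> and \<open>b\<close>.\<close>
    define k where "k = h ^^ (K - 1)"
    have kU: "k x \<in> U" if "x \<in> U" for x
      unfolding k_def by (rule funpow_closed[OF hU(1) that])
    have hk: "h (k x) = x" if "x \<in> U" for x
    proof -
      have "(h ^^ Suc (K - 1)) x = x" using funpow_K_id[OF _ that, of h] bij K_pos h_def by metis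
      then show ?thesis by (simp add: k_def)
    qed
    define g where "g x y = f (k (e x)) y" for x y
    have "pol2 g"
      using pol2_pol1_comp[of f "\<lambda>x. k (e x)" "\<lambda>x. x"] f pol1_id
        pol1_comp[OF pol1_funpow[OF hU(2)] e_pol]
      unfolding g_def k_def pol2_U_def by simp
    then have g: "pol2_U g"
      using f U_A e_U kU unfolding g_def pol2_U_def by (meson subsetD)
    have gr: "g x r = k x" "g x z = x" if "x \<in> U" for x
      using unit[OF kU[OF that]] hk[OF that] e_id[OF that] by (auto simp: g_def h_def)
    have "k x \<noteq> x" if "x \<in> T" for x
      using hk[of x] nofix[OF that] that T_U by (auto simp: h_def)
    then show ?thesis
      using rs rs_T rU gr pz by (intro splitsI[OF g p ab, of r s ?\<kappa>]) (auto split: if_splits)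
  qed
qed

text \<open>After normalisation \<open>r\<close> is a right unit, and \<open>a\<close>,
  \<open>b\<close> can be sent to \<open>r\<close> and another point \<open>z\<close> in some order.
  Either column \<open>z\<close> is a permutation, or its iterate drives all of \<open>U\<close> out
  of \<open>T\<close> and is absorbing, or the control can be moved from \<open>z\<close> into
  \<open>T\<close>, where all columns are permutations.\<close>

lemma quasigroup_splits:
  assumes f0: "pol2_U f0" and bij0: "\<And>x. x \<in> T \<Longrightarrow> bij_betw (f0 x) U U"
    and bijl0: "\<And>y. y \<in> T \<Longrightarrow> bij_betw (\<lambda>x. f0 x y) U U"
    and ab: "(r, s) \<in> Cg a b" "a \<in> A" "b \<in> A"
  shows "\<exists>\<kappa>. splits \<kappa> a b"
proof -
  have rU: "r \<in> U" "s \<in> U" using rs_T T_U by auto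
  define \<sigma> where "\<sigma> = (\<lambda>x. f0 x r)"
  have \<sigma>: "pol1 \<sigma>" "\<sigma> ` U \<subseteq> U" "bij_betw \<sigma> U U"
    using pol2_U_left[OF f0 rU(1)] bijl0[OF rs_T(1)] by (auto simp: \<sigma>_def)
  \<comment> \<open>Dividing by column \<open>r\<close> on the left makes that column the identity
    on \<open>U\<close>.\<close>
  define f where "f x y = (\<sigma> ^^ (K - 1)) (f0 x y)" for x y
  have f: "pol2_U f"
    unfolding pol2_U_def f_def
    using pol1_pol2_comp[OF pol1_funpow[OF \<sigma>(1)]] funpow_closed[OF \<sigma>(2)] f0
    by (auto simp: pol2_U_def)
  have unit: "f x r = x" if "x \<in> U" for x
  proof -
    have "(\<sigma> ^^ Suc (K - 1)) x = x" using funpow_K_id[OF \<sigma>(3) that] K_pos by metis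
    then have "(\<sigma> ^^ (K - 1)) (\<sigma> x) = x" by (simp only: funpow_Suc_right comp_apply)
    then show ?thesis by (simp add: f_def \<sigma>_def)
  qed
  have \<sigma>bij: "bij_betw (\<sigma> ^^ (K - 1)) U U" by (rule bij_betw_funpow_self[OF \<sigma>(3)])
  have bijT: "bij_betw (f x) U U" if "x \<in> T" for x
    using bij_betw_trans[OF bij0[OF that] \<sigma>bij] by (simp add: f_def[abs_def] comp_def)
  have bijl: "bij_betw (\<lambda>x. f x y) U U" if "y \<in> T" for y
    using bij_betw_trans[OF bijl0[OF that] \<sigma>bij] by (simp add: f_def comp_def)
  obtain p z where p: "pol1 p" and z: "z \<in> U" "z \<noteq> r"
    and pab: "e (p a) = r \<and> e (p b) = z \<or> e (p b) = r \<and> e (p a) = z"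
    using separating_pol1[OF ab rs(1) rU rs(2)] by blast
  show ?thesis
  proof (cases "bij_betw (\<lambda>x. f x z) U U")
    case True
    then show ?thesis using bij_control_splits[OF f unit bijT z True p ab(2,3) pab] by blast
  next
    case nb: False
    define g where "g x y = ((\<lambda>x. f x y) ^^ K) x" for x y
    have g: "pol2_U g" unfolding g_def by (rule pol2_U_iter_left[OF f])
    have "bij_betw (\<lambda>x. f x r) U U" by (rule bijl[OF rs_T(1)])
    then have keep: "g x r = x" if "x \<in> U" for x
      unfolding g_def using funpow_K_id that by blast
    show ?thesis
    proof (cases "\<forall>x\<in>U. g x z \<notin> T")
      case True
      have "z \<notin> T" using nb bijl by blast
      then show ?thesis
        using True by (intro absorbing_splits[OF g p ab(2,3), of r T z r z]) (use rU rs_T z keep pab in auto)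
    next
      case False
      then obtain x0 where x0: "x0 \<in> U" "g x0 z \<in> T" by blast
      define c where "c = g x0 z"
      have c: "c \<in> T" using x0 by (simp add: c_def)
      have "g c z = c"
        unfolding c_def g_def using pol2_U_left[OF f z(1)] x0(1) by (intro funpow_K_idem) auto
      have collapse: "g x z = c" if "x \<in> T" for x
      proof -
        have "f x z = f c z"
          using bij_if_moves_T[of "\<lambda>x. f x z" x c] pol2_U_left[OF f z(1)] that c nb by blast
        moreover have "g v z = ((\<lambda>x. f x z) ^^ (K - 1)) (f v z)" for v
          unfolding g_def by (subst K_pos) (simp only: funpow_Suc_right comp_apply)
        ultimately show ?thesis using \<open>g c z = c\<close> by metis
      qed
      obtain x where x: "x \<in> T" "x \<noteq> c" using rs_T rs(2) by metis
      have xU: "x \<in> U" using x T_U by auto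
      \<comment> \<open>This is the inverse of row \<open>x\<close>, so it sends
        \<open>x = f x r\<close> back to \<open>r\<close> and sends \<open>c\<close> to another
        point of \<open>T\<close>.\<close>
      define \<tau> where "\<tau> = f x ^^ (K - 1)"
      have \<tau>: "pol1 \<tau>" "bij_betw \<tau> U U"
        using pol1_funpow[of "f x" "K - 1"] pol2_U_right[OF f xU] bij_betw_funpow_self[OF bijT[OF x(1)]]
        by (auto simp: \<tau>_def)
      have "(f x ^^ Suc (K - 1)) r = r" using funpow_K_id[OF bijT[OF x(1)] rU(1)] K_pos by metis
      then have \<tau>x: "\<tau> x = r" using unit[OF xU] by (simp add: \<tau>_def funpow_swap1)
      define z' where "z' = \<tau> c"
      have z': "z' \<in> U" "z' \<noteq> r"
        using \<tau>(2) c T_U x xU \<tau>x unfolding z'_def by (auto simp: bij_betw_def dest: inj_onD)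
      have "(\<tau> x, \<tau> c) \<in> \<alpha>" by (rule congruence_pol1[OF cong \<tau>(1) T_related[OF x(1) c]])
      then have "z' \<in> T" using related_T[OF rs_T(1)] z' \<tau>x by (simp add: z'_def)
      then have bij': "bij_betw (\<lambda>x. f x z') U U" by (rule bijl)
      \<comment> \<open>Row \<open>x\<close> of \<open>g\<close> sends the control values
        \<open>r\<close> and \<open>z\<close> to \<open>x\<close> and \<open>c\<close>; then \<tau>
        sends these to \<open>r\<close> and \<open>z'\<close>, so \<open>q\<close> replaces
        \<open>z\<close> by \<open>z'\<close>.\<close>
      define q where "q y = \<tau> (g x (e (p y)))" for y
      have q: "pol1 q"
        using pol1_comp[OF \<tau>(1) pol1_comp[OF _ pol1_comp[OF e_pol p]], of "g x"]
          pol2_U_right[OF g xU] by (simp add: q_def[abs_def])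
      have "g x r = x" "g x z = c" using keep[OF xU] collapse[OF x(1)] by auto
      then have "e (q a) = r \<and> e (q b) = z' \<or> e (q b) = r \<and> e (q a) = z'"
        using pab \<tau>x z' e_id rU unfolding q_def z'_def by auto
      then show ?thesis using bij_control_splits[OF f unit bijT z' bij' q ab(2,3)] by blast
    qed
  qed
qed

text \<open>Failure of strong abelianness gives a binary polynomial depending on both variables over
  \<open>{r, s}\<close>, hence having a row and a column that permute \<open>U\<close>. Either all
  rows and columns over \<open>T\<close> do, or a mixed pair yields a semilattice operation.\<close>

lemma splits_if_not_strongly_abelian:
  assumes nsa: "\<not> strongly_abelian ar A F \<alpha>"
    and ab: "(r, s) \<in> Cg a b" "a \<in> A" "b \<in> A"
  shows "\<exists>\<kappa>. splits \<kappa> a b"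
proof -
  obtain f where f: "pol2_U f"
    and dep: "f r r \<noteq> f s r \<or> f r s \<noteq> f s s" "f r r \<noteq> f r s \<or> f s r \<noteq> f s s"
    using nsa strongly_abelian_if_unary unfolding pol2_U_def by blast
  have rU: "r \<in> U" "s \<in> U" using rs_T T_U by auto
  have l: "\<exists>y\<in>T. bij_betw (\<lambda>x. f x y) U U"
    using dep(1) bij_if_moves_T[of "\<lambda>x. f x r" r s] bij_if_moves_T[of "\<lambda>x. f x s" r s]
      pol2_U_left[OF f] rU rs_T by blast
  have r: "\<exists>x\<in>T. bij_betw (f x) U U"
    using dep(2) bij_if_moves_T[of "f r" r s] bij_if_moves_T[of "f s" r s]
      pol2_U_right[OF f] rU rs_T by blast
  consider "\<forall>x\<in>T. bij_betw (f x) U U" "\<forall>y\<in>T. bij_betw (\<lambda>x. f x y) U U"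
    | x where "x \<in> T" "\<not> bij_betw (f x) U U" | y where "y \<in> T" "\<not> bij_betw (\<lambda>x. f x y) U U"
    by blast
  then show ?thesis
  proof cases
    case 1
    then show ?thesis using quasigroup_splits[OF f _ _ ab] by blast
  next
    case 2
    then obtain g i j where "pol2_U g" "i \<in> T" "j \<in> T" "i \<noteq> j"
      "g i i = i" "g i j = j" "g j i = j" "g j j = j"
      using meet_if_mixed[OF f] r by blast
    then show ?thesis by (rule meet_splits[OF _ _ _ _ _ _ _ _ ab])
  next
    case 3
    then obtain g i j where "pol2_U g" "i \<in> T" "j \<in> T" "i \<noteq> j"
      "g i i = i" "g i j = j" "g j i = j" "g j j = j"
      using meet_if_mixed[OF pol2_U_swap[OF f]] l by blast
    then show ?thesis by (rule meet_splits[OF _ _ _ _ _ _ _ _ ab])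
  qed
qed

end

lemma (in finite_algebra) splits_if_no_strongly_abelian:
  assumes nsa: "\<And>\<theta>. congruence ar A F \<theta> \<Longrightarrow> \<theta> \<noteq> Id_on A \<Longrightarrow> \<not> strongly_abelian ar A F \<theta>"
    and ab: "a \<in> A" "b \<in> A" "a \<noteq> b"
  shows "\<exists>\<kappa>. splits \<kappa> a b"
proof -
  obtain \<alpha> e r s where ms: "minimal_set ar A F \<alpha> e r s" and cg: "(r, s) \<in> Cg a b"
    using minimal_set_exists[OF ab] by blast
  interpret minimal_set ar A F \<alpha> e r s by (rule ms)
  have "\<alpha> \<noteq> Id_on A" using minimal_set.rs(1,2)[OF ms] by auto
  then show ?thesis
    using splits_if_not_strongly_abelian[OF nsa cg ab(1,2)] cong by blast
qed

section \<open>Counting patterns\<close>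

text \<open>Every \<open>s\<close> outside \<open>P\<close> has at least two partners, so
  \<open>2 * card (fst\<close> followed by the image of \<open>E\<close> costs at most
  \<open>card E + card P\<close>. The pairs over \<open>P\<close> are disjoint from those with
  second component other than \<open>o1\<close>, and the latter realise all but at most one second
  component. Adding the two counts gives the bound.\<close>

lemma card_rel_doubling:
  fixes E :: "('s \<times> 't) set"
  assumes fin: "finite E"
    and dbl: "\<And>s t. (s, t) \<in> E \<Longrightarrow> t \<noteq> o1 \<Longrightarrow> \<exists>t'. t' \<noteq> t \<and> (s, t') \<in> E"
  shows "2 * card (fst ` E) + card (snd ` E) \<le> 2 * card E + 1"
proof -
  define P where "P = {s \<in> fst ` E. E `` {s} = {o1}}"
  have finP: "finite P" and PE: "P \<subseteq> fst ` E" using fin by (auto simp: P_def)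
  have finI: "finite (E `` {s})" for s
    using fin by (rule finite_Image)
  have "E = (SIGMA s : fst ` E. E `` {s})" by force
  then have "card E = (\<Sum>s\<in>fst ` E. card (E `` {s}))"
    using card_SigmaI[of "fst ` E" "\<lambda>s. E `` {s}"] fin finI by auto
  moreover have "(\<Sum>s\<in>fst ` E. if s \<in> P then 1 else 2) \<le> (\<Sum>s\<in>fst ` E. card (E `` {s}))"
  proof (rule sum_mono)
    fix s assume s: "s \<in> fst ` E"
    show "(if s \<in> P then 1 else 2) \<le> card (E `` {s})"
    proof (cases "s \<in> P")
      case True
      then show ?thesis by (simp add: P_def)
    next
      case False
      then obtain t where t: "(s, t) \<in> E" "t \<noteq> o1"
        using s unfolding P_def by fastforce
      then obtain t' where "t' \<noteq> t" "(s, t') \<in> E" using dbl by blast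
      then have "card {t, t'} \<le> card (E `` {s})" using t finI by (intro card_mono) auto
      then show ?thesis using False \<open>t' \<noteq> t\<close> by simp
    qed
  qed
  moreover have "(\<Sum>s\<in>fst ` E. if s \<in> P then 1 else 2) + card P = 2 * card (fst ` E)"
  proof -
    have "(\<Sum>s\<in>fst ` E. if s \<in> P then 1 else 2) = (\<Sum>s\<in>fst ` E - P. 2) + (\<Sum>s\<in>P. 1 :: nat)"
      using fin PE by (subst sum.subset_diff[of P "fst ` E"]) auto
    moreover have "card (fst ` E - P) + card P = card (fst ` E)"
      using fin PE finP by (metis card_Diff_subset card_mono finite_imageI le_add_diff_inverse2)
    ultimately show ?thesis by simp
  qed
  ultimately have 1: "2 * card (fst ` E) \<le> card E + card P" by linarith
  let ?E' = "{p \<in> E. snd p \<noteq> o1}"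
  have "card (P \<times> {o1} \<union> ?E') \<le> card E" using fin by (intro card_mono) (auto simp: P_def)
  moreover have "card (P \<times> {o1} \<union> ?E') = card P + card ?E'"
    using fin finP by (subst card_Un_disjoint) (auto simp: card_cartesian_product)
  ultimately have "card P + card ?E' \<le> card E" by simp
  moreover have "card (snd ` E - {o1}) \<le> card ?E'"
  proof -
    have "snd ` E - {o1} = snd ` ?E'" by auto
    then show ?thesis using fin by (simp add: card_image_le)
  qed
  moreover have "card (snd ` E) \<le> card (snd ` E - {o1}) + 1"
    using diff_card_le_card_Diff[of "{o1}" "snd ` E"] by simp
  ultimately show ?thesis using 1 by linarith
qed

text \<open>The relation contains a full row over \<open>o1\<close>, plus at least one pair for
  every other first component.\<close>

lemma card_rel_absorbing:
  fixes E :: "('s \<times> 't) set"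
  assumes fin: "finite E" and abs: "\<And>s t. (s, t) \<in> E \<Longrightarrow> (o1, t) \<in> E"
  shows "card (fst ` E) + card (snd ` E) \<le> card E + 1"
proof -
  let ?E' = "{p \<in> E. fst p \<noteq> o1}"
  have "card ({o1} \<times> snd ` E \<union> ?E') \<le> card E" using fin abs by (intro card_mono) auto
  moreover have "card ({o1} \<times> snd ` E \<union> ?E') = card (snd ` E) + card ?E'"
    using fin by (subst card_Un_disjoint) (auto simp: card_cartesian_product)
  ultimately have "card (snd ` E) + card ?E' \<le> card E" by simp
  moreover have "card (fst ` E - {o1}) \<le> card ?E'"
  proof -
    have "fst ` E - {o1} = fst ` ?E'" by auto
    then show ?thesis using fin by (simp add: card_image_le)
  qed
  moreover have "card (fst ` E) \<le> card (fst ` E - {o1}) + 1"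
    using diff_card_le_card_Diff[of "{o1}" "fst ` E"] by simp
  ultimately show ?thesis by linarith
qed

lemma power_first_order_bound:
  fixes u d :: real
  assumes "0 \<le> u" "0 \<le> d"
  shows "u ^ Suc k + real (Suc k) * u ^ k * d \<le> (u + d) ^ Suc k"
proof (induction k)
  case (Suc k)
  have "u ^ Suc (Suc k) + real (Suc (Suc k)) * u ^ Suc k * d
      \<le> (u ^ Suc k + real (Suc k) * u ^ k * d) * (u + d)"
    using assms by (simp add: algebra_simps)
  also have "\<dots> \<le> (u + d) ^ Suc k * (u + d)"
    using Suc assms by (intro mult_right_mono) auto
  finally show ?case by (simp add: mult.commute)
qed simp

text \<open>The numerical induction step: \<open>x\<close> and \<open>y\<close> bound the largest
  and second largest of \<open>q\<close> classes. The exponent \<open>4 * q\<close> cancels the loss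
  of a factor 4 in \<open>w\<close>: the linear term of \<open>(u + m / 4) ^ (4 * q)\<close> in
  \<open>m\<close> is \<open>q * u ^ (4 * q - 1) * m\<close>, which dominates
  \<open>q * m ^ (4 * q)\<close> for \<open>m \<le> u\<close>.\<close>

lemma split_power_bound:
  fixes x y u v w q :: nat
  assumes w: "4 * u + v \<le> 4 * w" and x: "x \<le> u ^ (4 * q)" and y: "y \<le> v ^ (4 * q)"
    and yx: "y \<le> x" and q: "0 < q"
  shows "x + q * y \<le> w ^ (4 * q)"
proof -
  \<comment> \<open>Only \<open>y \<le> v ^ (4 * q)\<close> is needed of \<open>v\<close>, so it may be lowered to \<open>min u v\<close>.\<close>
  define m where "m = min u v"
  have m: "m \<le> u" "y \<le> m ^ (4 * q)" "4 * u + m \<le> 4 * w"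
    using x y yx w by (auto simp: m_def min_def)
  obtain k where k: "4 * q = Suc k" using q by (cases "4 * q") auto
  have "real q * real m ^ (4 * q) \<le> real q * (real u ^ k * real m)"
    using m unfolding k by (simp add: mult.commute mult_right_mono power_mono mult_left_mono)
  also have "\<dots> = real (Suc k) * real u ^ k * (real m / 4)"
    using arg_cong[OF k, of real, symmetric] by simp
  finally have "real u ^ (4 * q) + real q * real m ^ (4 * q)
      \<le> real u ^ Suc k + real (Suc k) * real u ^ k * (real m / 4)"
    using k by simp
  also have "\<dots> \<le> (real u + real m / 4) ^ Suc k"
    by (rule power_first_order_bound) auto
  also have "\<dots> \<le> real w ^ Suc k"
    using m(3) by (intro power_mono) auto
  finally have "real (u ^ (4 * q) + q * m ^ (4 * q)) \<le> real (w ^ (4 * q))"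
    using k by simp
  then have "u ^ (4 * q) + q * m ^ (4 * q) \<le> w ^ (4 * q)" by linarith
  moreover have "x + q * y \<le> u ^ (4 * q) + q * m ^ (4 * q)"
    using x m(2) by (intro add_mono mult_left_mono) auto
  ultimately show ?thesis by linarith
qed

text \<open>Each \<open>x\<close> in \<open>X\<close> acts as the function sending \<open>h\<close>
  to \<open>h x\<close> on \<open>J\<close>. By \<open>diagonal\<close> the constants are among
  these functions, by \<open>closed\<close> they are preserved by binary polynomials, and by
  \<open>sep\<close> they separate the members of \<open>J\<close>.\<close>

locale separating_family = finite_algebra ar A F
  for ar :: "'f \<Rightarrow> nat" and A :: "'a set" and F :: "'f \<Rightarrow> 'a list \<Rightarrow> 'a" +
  fixes X :: "'x set" and J :: "('x \<Rightarrow> 'a) set"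
  assumes fX: "finite X" and X_ne: "X \<noteq> {}" and fJ: "finite J"
    and vals: "h \<in> J \<Longrightarrow> x \<in> X \<Longrightarrow> h x \<in> A"
    and sep: "h \<in> J \<Longrightarrow> h' \<in> J \<Longrightarrow> h \<noteq> h' \<Longrightarrow> \<exists>x\<in>X. h x \<noteq> h' x"
    and diagonal: "c \<in> A \<Longrightarrow> \<exists>x\<in>X. \<forall>h\<in>J. h x = c"
    and closed: "pol2 f \<Longrightarrow> x \<in> X \<Longrightarrow> y \<in> X \<Longrightarrow> \<exists>z\<in>X. \<forall>h\<in>J. h z = f (h x) (h y)"
begin

definition pattern :: "('a \<Rightarrow> 'a option) \<Rightarrow> ('x \<Rightarrow> 'a) set \<Rightarrow> 'x \<Rightarrow> ('x \<Rightarrow> 'a) \<Rightarrow> 'a option" where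
  "pattern \<kappa> I x = (\<lambda>h\<in>I. \<kappa> (h x))"

definition patterns :: "('a \<Rightarrow> 'a option) \<Rightarrow> ('x \<Rightarrow> 'a) set \<Rightarrow> nat" where
  "patterns \<kappa> I = card (pattern \<kappa> I ` X)"

lemma pattern_eq_iff: "pattern \<kappa> I x = pattern \<kappa> I y \<longleftrightarrow> (\<forall>h\<in>I. \<kappa> (h x) = \<kappa> (h y))"
  unfolding pattern_def by (auto simp: fun_eq_iff restrict_def)

lemma patterns_mono: "I \<subseteq> I' \<Longrightarrow> patterns \<kappa> I \<le> patterns \<kappa> I'"
proof -
  assume "I \<subseteq> I'"
  then have "pattern \<kappa> I ` X = (\<lambda>p. restrict p I) ` (pattern \<kappa> I' ` X)"
    by (force simp: pattern_def image_image fun_eq_iff restrict_def intro!: image_cong)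
  then show ?thesis unfolding patterns_def using fX by (simp add: card_image_le)
qed

lemma patterns_pos: "1 \<le> patterns \<kappa> I" and patterns_le: "patterns \<kappa> I \<le> card X"
  using fX X_ne unfolding patterns_def by (auto simp: card_image_le Suc_le_eq card_gt_0_iff)

lemma patterns_ge_2:
  assumes "I \<subseteq> J" "I \<noteq> {}" "c \<in> A" "c' \<in> A" "\<kappa> c \<noteq> \<kappa> c'"
  shows "2 \<le> patterns \<kappa> I"
proof -
  obtain x where x: "x \<in> X" "\<forall>h\<in>J. h x = c" using diagonal[OF assms(3)] by blast
  obtain y where y: "y \<in> X" "\<forall>h\<in>J. h y = c'" using diagonal[OF assms(4)] by blast
  have "pattern \<kappa> I x \<noteq> pattern \<kappa> I y"
    unfolding pattern_eq_iff using x y assms by (metis all_not_in_conv subsetD)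
  then have "card {pattern \<kappa> I x, pattern \<kappa> I y} = 2" by simp
  moreover have "card {pattern \<kappa> I x, pattern \<kappa> I y} \<le> patterns \<kappa> I"
    unfolding patterns_def using x y fX by (intro card_mono) auto
  ultimately show ?thesis by simp
qed

text \<open>Combining \<open>y\<close> with \<open>x\<close> through \<open>f\<close> applies the
  control \<open>a\<close> on \<open>I1\<close> and \<open>b\<close> on \<open>I2\<close>. The first
  alternative of \<open>splits\<close> fixes the pattern on \<open>I1\<close> and changes any
  non-neutral one on \<open>I2\<close>; the second fixes the pattern on \<open>I2\<close> and erases
  the one on \<open>I1\<close>. The two counting lemmas on relations match these cases.\<close>

lemma patterns_split:
  assumes I: "I1 \<subseteq> J" "I2 \<subseteq> J" "I2 \<noteq> {}"
    and x: "x \<in> X" "\<And>h. h \<in> I1 \<Longrightarrow> h x = a" "\<And>h. h \<in> I2 \<Longrightarrow> h x = b"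
    and splits: "splits \<kappa> a b"
  shows "4 * patterns \<kappa> I1 + patterns \<kappa> I2 \<le> 4 * patterns \<kappa> (I1 \<union> I2)"
proof -
  obtain f c c' where f: "pol2 f" and nc: "c \<in> A" "c' \<in> A" "\<kappa> c \<noteq> \<kappa> c'"
    and act: "(\<forall>x\<in>A. \<kappa> (f x a) = \<kappa> x \<and> (\<kappa> x \<noteq> None \<longrightarrow> \<kappa> (f x b) \<noteq> \<kappa> x)) \<or>
      (\<forall>x\<in>A. \<kappa> (f x b) = \<kappa> x \<and> \<kappa> (f x a) = None)"
    using splits unfolding splits_def by blast
  define E where "E = (\<lambda>y. (pattern \<kappa> I1 y, pattern \<kappa> I2 y)) ` X"
  have finE: "finite E" using fX by (simp add: E_def)
  have "E = (\<lambda>p. (restrict p I1, restrict p I2)) ` (pattern \<kappa> (I1 \<union> I2) ` X)"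
    unfolding E_def image_image
    by (intro image_cong) (auto simp: pattern_def fun_eq_iff restrict_def)
  then have E: "card E \<le> patterns \<kappa> (I1 \<union> I2)"
    unfolding patterns_def using fX by (simp add: card_image_le)
  have proj: "card (fst ` E) = patterns \<kappa> I1" "card (snd ` E) = patterns \<kappa> I2"
    by (simp_all add: E_def patterns_def image_image)
  \<comment> \<open>A second pattern on \<open>I2\<close> pays for the summand 1 in both counting
    lemmas; in the doubling case this leaves a quarter of
    \<open>patterns \<kappa> I2\<close>.\<close>
  have two: "2 \<le> patterns \<kappa> I2" by (rule patterns_ge_2[where c=c and c'=c']) (use I nc in auto)
  have comb: "\<exists>z\<in>X. (\<forall>h\<in>I1. h z = f (h y) a) \<and> (\<forall>h\<in>I2. h z = f (h y) b)" if "y \<in> X" for y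
    using closed[OF f that x(1)] x(2,3) I by (metis subsetD)
  show ?thesis
    using act
  proof
    assume "\<forall>x\<in>A. \<kappa> (f x a) = \<kappa> x \<and> (\<kappa> x \<noteq> None \<longrightarrow> \<kappa> (f x b) \<noteq> \<kappa> x)"
    then have keep: "\<forall>x\<in>A. \<kappa> (f x a) = \<kappa> x" and alter: "\<forall>x\<in>A. \<kappa> x \<noteq> None \<longrightarrow> \<kappa> (f x b) \<noteq> \<kappa> x"
      by blast+
    have "2 * card (fst ` E) + card (snd ` E) \<le> 2 * card E + 1"
    proof (rule card_rel_doubling[OF finE, where ?o1.0 = "\<lambda>h\<in>I2. None"])
      fix s t assume "(s, t) \<in> E" and t: "t \<noteq> (\<lambda>h\<in>I2. None)"
      then obtain y where y: "y \<in> X" "s = pattern \<kappa> I1 y" "t = pattern \<kappa> I2 y"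
        by (auto simp: E_def)
      obtain z where z: "z \<in> X" "\<And>h. h \<in> I1 \<Longrightarrow> h z = f (h y) a" "\<And>h. h \<in> I2 \<Longrightarrow> h z = f (h y) b"
        using comb[OF y(1)] by blast
      obtain h where h: "h \<in> I2" "\<kappa> (h y) \<noteq> None"
        using t y(3) unfolding pattern_def by (auto simp: fun_eq_iff restrict_def split: if_splits)
      have "h y \<in> A" using vals y(1) h(1) I(2) by blast
      then have "\<kappa> (h z) \<noteq> \<kappa> (h y)" using alter h(2) unfolding z(3)[OF h(1)] by blast
      then have "pattern \<kappa> I2 z \<noteq> t"
        unfolding y(3) pattern_eq_iff using h(1) by blast
      moreover have "pattern \<kappa> I1 z = s"
        unfolding y(2) pattern_eq_iff using z(2) keep vals[OF _ y(1)] I(1) by (metis subsetD)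
      ultimately show "\<exists>t'. t' \<noteq> t \<and> (s, t') \<in> E" using z(1) unfolding E_def by blast
    qed
    then show ?thesis using E proj two by linarith
  next
    assume "\<forall>x\<in>A. \<kappa> (f x b) = \<kappa> x \<and> \<kappa> (f x a) = None"
    then have keep: "\<forall>x\<in>A. \<kappa> (f x b) = \<kappa> x" and erase: "\<forall>x\<in>A. \<kappa> (f x a) = None"
      by blast+
    have "card (fst ` E) + card (snd ` E) \<le> card E + 1"
    proof (rule card_rel_absorbing[OF finE, where ?o1.0 = "\<lambda>h\<in>I1. None"])
      fix s t assume "(s, t) \<in> E"
      then obtain y where y: "y \<in> X" "t = pattern \<kappa> I2 y"
        by (auto simp: E_def)
      obtain z where z: "z \<in> X" "\<And>h. h \<in> I1 \<Longrightarrow> h z = f (h y) a" "\<And>h. h \<in> I2 \<Longrightarrow> h z = f (h y) b"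
        using comb[OF y(1)] by blast
      have "pattern \<kappa> I2 z = t"
        unfolding y(2) pattern_eq_iff using z(3) keep vals[OF _ y(1)] I(2) by (metis subsetD)
      moreover have "pattern \<kappa> I1 z = (\<lambda>h\<in>I1. None)"
        unfolding pattern_def
        using z(2) erase vals[OF _ y(1)] I(1) by (intro restrict_ext) (metis subsetD)
      ultimately show "((\<lambda>h\<in>I1. None), t) \<in> E" using z(1) unfolding E_def by force
    qed
    then show ?thesis using E proj two by linarith
  qed
qed

text \<open>The map \<kappa> depends on the pair of values being split, so the potential \<psi>
  multiplies the pattern counts over all pairs. At each splitting one factor grows by
  \<open>patterns_split\<close> while the others are monotone.\<close>

lemma card_le_power:
  assumes splits: "\<And>a b. a \<in> A \<Longrightarrow> b \<in> A \<Longrightarrow> a \<noteq> b \<Longrightarrow> \<exists>\<kappa>. splits \<kappa> a b"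
  shows "card J \<le> card X ^ (4 * card A ^ 3)"
proof (cases "J = {}")
  case False
  then have "A \<noteq> {}" using X_ne vals by blast
  then have q: "0 < card A" using finite_carrier by (simp add: card_gt_0_iff)
  obtain \<kappa> where \<kappa>: "\<And>a b. a \<in> A \<Longrightarrow> b \<in> A \<Longrightarrow> a \<noteq> b \<Longrightarrow> splits (\<kappa> a b) a b"
    using splits by metis
  define \<psi> where "\<psi> I = (\<Prod>(a, b)\<in>A \<times> A. patterns (\<kappa> a b) I)" for I
  have finAA: "finite (A \<times> A)" using finite_carrier by simp
  have \<psi>_pos: "1 \<le> \<psi> I" for I
    unfolding \<psi>_def using patterns_pos by (intro prod_ge_1) (auto simp: case_prod_unfold)
  have \<psi>_split: "4 * \<psi> I1 + \<psi> I2 \<le> 4 * \<psi> I"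
    if I: "I1 \<subseteq> I" "I2 \<subseteq> I" "I \<subseteq> J" "I2 \<noteq> {}" and ab: "a \<in> A" "b \<in> A" "a \<noteq> b"
      and x: "x \<in> X" "\<And>h. h \<in> I1 \<Longrightarrow> h x = a" "\<And>h. h \<in> I2 \<Longrightarrow> h x = b" for I I1 I2 a b x
  proof -
    define \<rho> where "\<rho> I = (\<Prod>(a, b)\<in>A \<times> A - {(a, b)}. patterns (\<kappa> a b) I)" for I
    have fact: "\<psi> I = patterns (\<kappa> a b) I * \<rho> I" for I
      unfolding \<psi>_def \<rho>_def using ab finAA by (subst prod.remove[of _ "(a, b)"]) auto
    have \<rho>: "\<rho> I1 \<le> \<rho> I" "\<rho> I2 \<le> \<rho> I"
      unfolding \<rho>_def using I patterns_mono by (auto intro!: prod_mono)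
    have "4 * patterns (\<kappa> a b) I1 + patterns (\<kappa> a b) I2 \<le> 4 * patterns (\<kappa> a b) (I1 \<union> I2)"
      using \<kappa>[OF ab] by (rule patterns_split[where x=x, rotated -1]) (use I x in auto)
    also have "\<dots> \<le> 4 * patterns (\<kappa> a b) I" using I patterns_mono[of "I1 \<union> I2" I] by simp
    finally have main: "4 * patterns (\<kappa> a b) I1 + patterns (\<kappa> a b) I2 \<le> 4 * patterns (\<kappa> a b) I" .
    have "4 * \<psi> I1 + \<psi> I2 \<le> 4 * patterns (\<kappa> a b) I1 * \<rho> I + patterns (\<kappa> a b) I2 * \<rho> I"
      unfolding fact using \<rho> by (intro add_mono) (simp_all add: mult.assoc)
    also have "\<dots> = (4 * patterns (\<kappa> a b) I1 + patterns (\<kappa> a b) I2) * \<rho> I"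
      by (simp add: algebra_simps)
    also have "\<dots> \<le> 4 * patterns (\<kappa> a b) I * \<rho> I" using main by (rule mult_right_mono) simp
    finally show ?thesis by (simp add: fact mult.assoc)
  qed
  have "card I \<le> \<psi> I ^ (4 * card A)" if "I \<subseteq> J" for I
    using finite_subset[OF that fJ] that
  proof (induction rule: finite_psubset_induct)
    case (psubset I)
    show ?case
    proof (cases "card I \<le> 1")
      case True
      then show ?thesis using one_le_power[OF \<psi>_pos] by (meson le_trans)
    next
      case False
      then obtain h h' where h: "h \<in> I" "h' \<in> I" "h \<noteq> h'"
        using psubset.hyps by (metis One_nat_def card_le_Suc0_iff_eq)
      then obtain x where x: "x \<in> X" "h x \<noteq> h' x" using sep psubset.prems by blast
      define N where "N c = {g \<in> I. g x = c}" for c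
      have finN: "finite (N c)" for c using psubset.hyps by (simp add: N_def)
      have max: "\<exists>a\<in>S. \<forall>c\<in>S. card (N c) \<le> card (N a)" if "finite S" "S \<noteq> {}" for S
      proof -
        have "Max ((\<lambda>c. card (N c)) ` S) \<in> (\<lambda>c. card (N c)) ` S" using that by (intro Max_in) auto
        moreover have "card (N c) \<le> Max ((\<lambda>c. card (N c)) ` S)" if "c \<in> S" for c
          using \<open>finite S\<close> that by (intro Max_ge) auto
        ultimately show ?thesis by fastforce
      qed
      \<comment> \<open>Let \<open>a\<close> be a most frequent value at \<open>x\<close> and
        \<open>b\<close> a most frequent one among the rest: all classes other than
        \<open>N a\<close> together have at most \<open>card A * card (N b)\<close> members.\<close>
      obtain a where a: "a \<in> A" "\<And>c. c \<in> A \<Longrightarrow> card (N c) \<le> card (N a)"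
        using max[OF finite_carrier \<open>A \<noteq> {}\<close>] by blast
      have "h x \<in> A" "h' x \<in> A" using h x vals psubset.prems by auto
      then have "A - {a} \<noteq> {}" using x(2) by auto
      then obtain b where b: "b \<in> A - {a}" "\<And>c. c \<in> A - {a} \<Longrightarrow> card (N c) \<le> card (N b)"
        using max[of "A - {a}"] finite_carrier by blast
      have Nb: "N b \<noteq> {}"
      proof -
        obtain g where g: "g \<in> I" "g x \<noteq> a" using h x(2) by metis
        then have "g x \<in> A - {a}" using vals x(1) psubset.prems by auto
        moreover have "card (N (g x)) > 0" using g finN by (auto simp: N_def card_gt_0_iff)
        ultimately show ?thesis using b(2)[of "g x"] by auto
      qed
      have Na: "N a \<noteq> {}"
        using a(2)[of b] b(1) Nb finN by (metis Diff_iff card_eq_0_iff le_zero_eq)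
      have "I = (\<Union>c\<in>A. N c)" using vals x(1) psubset.prems by (auto simp: N_def)
      then have "card I \<le> (\<Sum>c\<in>A. card (N c))" using finite_carrier by (metis card_UN_le)
      also have "\<dots> = card (N a) + (\<Sum>c\<in>A - {a}. card (N c))"
        using a(1) finite_carrier by (simp add: sum.remove)
      also have "(\<Sum>c\<in>A - {a}. card (N c)) \<le> card (A - {a}) * card (N b)"
        using b(2) by (intro sum_bounded_above[where 'a = nat, simplified]) auto
      also have "\<dots> \<le> card A * card (N b)"
        using finite_carrier by (intro mult_right_mono card_mono) auto
      finally have "card I \<le> card (N a) + card A * card (N b)" by simp
      also have "\<dots> \<le> \<psi> I ^ (4 * card A)"
      proof (rule split_power_bound[OF _ _ _ _ q])
        show "4 * \<psi> (N a) + \<psi> (N b) \<le> 4 * \<psi> I"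
          by (rule \<psi>_split[where a=a and b=b and x=x])
            (use a b x(1) Nb psubset.prems in \<open>auto simp: N_def\<close>)
        have "N a \<subseteq> I" "N b \<subseteq> I" "N a \<inter> N b = {}" using b(1) by (auto simp: N_def)
        then have "N a \<subset> I" "N b \<subset> I" using Na Nb by blast+
        then show "card (N a) \<le> \<psi> (N a) ^ (4 * card A)" "card (N b) \<le> \<psi> (N b) ^ (4 * card A)"
          using psubset.IH psubset.prems by auto
        show "card (N b) \<le> card (N a)" using a b by auto
      qed
      finally show ?thesis .
    qed
  qed
  then have "card J \<le> \<psi> J ^ (4 * card A)" by simp
  also have "\<psi> J \<le> (\<Prod>p\<in>A \<times> A. card X)"
    unfolding \<psi>_def using patterns_le by (intro prod_mono) auto
  then have "\<psi> J ^ (4 * card A) \<le> (card X ^ (card A * card A)) ^ (4 * card A)"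
    by (intro power_mono) (auto simp: card_cartesian_product)
  also have "\<dots> = card X ^ (4 * card A ^ 3)"
    by (simp add: power_mult[symmetric] power3_eq_cube algebra_simps)
  finally show ?thesis .
qed simp

end

section \<open>The polynomial upper bound\<close>

lemma homs_subset_PiE: "homs ar X G A F \<subseteq> X \<rightarrow>\<^sub>E A"
  unfolding homs_def is_hom_def PiE_def extensional_def by auto

lemma finite_homs: "finite X \<Longrightarrow> finite A \<Longrightarrow> finite (homs ar X G A F)"
  by (rule finite_subset[OF homs_subset_PiE]) (rule finite_PiE, auto)

lemma hom_app:
  "h \<in> homs ar X G A F \<Longrightarrow> length xs = ar f \<Longrightarrow> set xs \<subseteq> X \<Longrightarrow> h (G f xs) = F f (map h xs)"
  unfolding homs_def is_hom_def by auto

lemma subalgebra_hom_image: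
  assumes "is_algebra ar X G" and h: "h \<in> homs ar X G A F"
  shows "subalgebra ar A F (h ` X)"
  unfolding subalgebra_def is_algebra_def
proof (intro conjI allI impI)
  show "h ` X \<subseteq> A" using h unfolding homs_def is_hom_def by auto
  fix f ys assume "length ys = ar f \<and> set ys \<subseteq> h ` X"
  then have len: "length ys = ar f" and "set ys \<subseteq> h ` X" by auto
  then have "ys \<in> map h ` lists X" by (metis in_lists_conv_set lists_image subsetD)
  then obtain xs where xs: "ys = map h xs" "set xs \<subseteq> X" by auto
  then have "G f xs \<in> X" "h (G f xs) = F f ys"
    using assms(1) len hom_app[OF h] unfolding is_algebra_def by auto
  then show "F f ys \<in> h ` X" by force
qed

text \<open>The polynomial is evaluated inside \<open>X\<close>, each constant being replaced by a
  point where all of \<open>J\<close> takes that value; homomorphisms then carry the result to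
  \<open>A\<close>.\<close>

lemma poly_realized:
  assumes X: "is_algebra ar X G" and J: "J \<subseteq> homs ar X G A F"
    and diagonal: "\<And>c. c \<in> B \<Longrightarrow> \<exists>x\<in>X. \<forall>h\<in>J. h x = c"
    and p: "polyf ar B F p" and xs: "\<And>i. xs i \<in> X"
  shows "\<exists>z\<in>X. \<forall>h\<in>J. h z = p (\<lambda>i. h (xs i))"
  using p
proof (induction rule: polyf.induct)
  case (var i)
  then show ?case using xs by blast
next
  case (const c)
  then show ?case using diagonal by blast
next
  case (app ps f)
  then obtain Z where Z: "\<And>p. p \<in> set ps \<Longrightarrow> Z p \<in> X"
    "\<And>p h. p \<in> set ps \<Longrightarrow> h \<in> J \<Longrightarrow> h (Z p) = p (\<lambda>i. h (xs i))"
    by metis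
  have args: "length (map Z ps) = ar f" "set (map Z ps) \<subseteq> X"
    using Z(1) app.hyps(1) by auto
  then have "G f (map Z ps) \<in> X"
    using X unfolding is_algebra_def by blast
  moreover have "h (G f (map Z ps)) = F f (map (\<lambda>p. p (\<lambda>i. h (xs i))) ps)" if "h \<in> J" for h
  proof -
    have "h (G f (map Z ps)) = F f (map h (map Z ps))"
      using hom_app[OF subsetD[OF J that] args] .
    also have "map h (map Z ps) = map (\<lambda>p. p (\<lambda>i. h (xs i))) ps"
      using Z(2) that by simp
    finally show ?thesis .
  qed
  ultimately show ?case by blast
qed

text \<open>A homomorphism is labelled by its image together with a chosen preimage of each element of
  the image. Homomorphisms with the same label make the carrier \<open>X\<close> contain all constants.\<close>
definition hom_fibre ::
  "'b set \<Rightarrow> 'a set \<Rightarrow> ('b \<Rightarrow> 'a) set \<Rightarrow> ('a \<Rightarrow> 'b option) \<Rightarrow> ('b \<Rightarrow> 'a) set" where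
  "hom_fibre X A H \<rho> = {h \<in> H. \<forall>b\<in>A. case \<rho> b of None \<Rightarrow> b \<notin> h ` X | Some x \<Rightarrow> x \<in> X \<and> h x = b}"

lemma homs_covered_by_fibres:
  "homs ar X G A F
     \<subseteq> (\<Union>\<rho>\<in>A \<rightarrow>\<^sub>E insert None (Some ` X). hom_fibre X A (homs ar X G A F) \<rho>)"
proof
  fix h assume h: "h \<in> homs ar X G A F"
  define \<rho> where
    "\<rho> = (\<lambda>b\<in>A. if b \<in> h ` X then Some (inv_into X h b) else None)"
  have "\<rho> \<in> A \<rightarrow>\<^sub>E insert None (Some ` X)"
    by (auto simp: \<rho>_def inv_into_into)
  moreover have "h \<in> hom_fibre X A (homs ar X G A F) \<rho>"
    unfolding hom_fibre_def using h by (auto simp: \<rho>_def inv_into_into f_inv_into_f)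
  ultimately show "h \<in> (\<Union>\<rho>\<in>A \<rightarrow>\<^sub>E insert None (Some ` X). hom_fibre X A (homs ar X G A F) \<rho>)"
    by blast
qed

text \<open>All homomorphisms in a fibre share the image \<open>B\<close>, a subalgebra, and the
  preimages prescribed by \<rho> provide its constants. They form a separating family over
  \<open>B\<close>, which is why the hypothesis must cover all subalgebras.\<close>

lemma card_hom_fibre_le:
  assumes finA: "finite A" and X: "is_algebra ar X G" "finite X" "X \<noteq> {}"
    and nsa: "\<And>B \<theta>. subalgebra ar A F B \<Longrightarrow> congruence ar B F \<theta> \<Longrightarrow> \<theta> \<noteq> Id_on B
      \<Longrightarrow> \<not> strongly_abelian ar B F \<theta>"
  shows "card (hom_fibre X A (homs ar X G A F) \<rho>) \<le> card X ^ (4 * card A ^ 3)"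
proof (cases "hom_fibre X A (homs ar X G A F) \<rho> = {}")
  case False
  define J where "J = hom_fibre X A (homs ar X G A F) \<rho>"
  define B where "B = {b \<in> A. \<rho> b \<noteq> None}"
  have JH: "J \<subseteq> homs ar X G A F" by (auto simp: J_def hom_fibre_def)
  have hA: "h x \<in> A" if "h \<in> J" "x \<in> X" for h x
    using that JH homs_subset_PiE[of ar X G A F] by (auto simp: PiE_def Pi_def)
  have pre: "\<exists>x\<in>X. \<forall>h\<in>J. h x = c" if c: "c \<in> B" for c
  proof -
    obtain x where x: "\<rho> c = Some x" "c \<in> A" using c by (auto simp: B_def)
    have "x \<in> X" "h x = c" if "h \<in> J" for h
      using that x unfolding J_def hom_fibre_def by fastforce+
    then show ?thesis using False J_def by blast
  qed
  have img: "h ` X = B" if "h \<in> J" for h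
  proof
    show "h ` X \<subseteq> B"
    proof
      fix b assume b: "b \<in> h ` X"
      then have "b \<in> A" using hA[OF that] by auto
      then show "b \<in> B"
        using that b by (cases "\<rho> b") (auto simp: J_def hom_fibre_def B_def split: option.splits)
    qed
    show "B \<subseteq> h ` X"
    proof
      fix b assume "b \<in> B"
      with pre that obtain x where "x \<in> X" "h x = b" by meson
      then show "b \<in> h ` X" by auto
    qed
  qed
  obtain h0 where "h0 \<in> J" using False J_def by blast
  then have sub: "subalgebra ar A F B"
    using subalgebra_hom_image[OF X(1), of h0] JH img by auto
  then have BA: "B \<subseteq> A" "is_algebra ar B F" by (auto simp: subalgebra_def)
  interpret B: finite_algebra ar B F
    using BA finA by unfold_locales (auto intro: finite_subset)
  interpret separating_family ar B F X J
  proof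
    show "finite X" "X \<noteq> {}" by (fact X)+
    show "finite J" by (rule finite_subset[OF JH finite_homs[OF X(2) finA]])
    show "h x \<in> B" if "h \<in> J" "x \<in> X" for h x using img[OF that(1)] that(2) by blast
    show "\<exists>x\<in>X. h x \<noteq> h' x" if "h \<in> J" "h' \<in> J" "h \<noteq> h'" for h h'
      using that JH homs_subset_PiE[of ar X G A F] by (metis PiE_ext subsetD)
    show "\<exists>x\<in>X. \<forall>h\<in>J. h x = c" if "c \<in> B" for c by (rule pre[OF that])
    show "\<exists>z\<in>X. \<forall>h\<in>J. h z = f (h x) (h y)" if f: "B.pol2 f" and xy: "x \<in> X" "y \<in> X" for f x y
    proof -
      have "\<exists>z\<in>X. \<forall>h\<in>J. h z = f (h (if (0::nat) = 0 then x else y)) (h (if (1::nat) = 0 then x else y))"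
        using xy by (intro poly_realized[OF X(1) JH pre f[unfolded B.pol2_def], of "\<lambda>i. if i = 0 then x else y"]) auto
      then show ?thesis by simp
    qed
  qed
  have "card J \<le> card X ^ (4 * card B ^ 3)"
    by (rule card_le_power) (rule B.splits_if_no_strongly_abelian[OF nsa[OF sub]])
  also have "\<dots> \<le> card X ^ (4 * card A ^ 3)"
    using X(2,3) BA finA
    by (intro power_increasing mult_left_mono power_mono card_mono) (auto simp: Suc_le_eq card_gt_0_iff)
  finally show ?thesis by (simp add: J_def)
qed simp

text \<open>There are \<open>(card X + 1) ^ card A\<close> labels, the extra 1 standing for
  \<open>None\<close>, and each fibre is bounded separately.\<close>

lemma card_homs_le:
  assumes finA: "finite A" and X: "is_algebra ar X G" "finite X"
    and nsa: "\<And>B \<theta>. subalgebra ar A F B \<Longrightarrow> congruence ar B F \<theta> \<Longrightarrow> \<theta> \<noteq> Id_on B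
      \<Longrightarrow> \<not> strongly_abelian ar B F \<theta>"
  shows "card (homs ar X G A F) \<le> (card X + 1) ^ (card A + 4 * card A ^ 3)"
proof (cases "X = {}")
  case True
  then have "homs ar X G A F \<subseteq> {\<lambda>_. undefined}" using homs_subset_PiE[of ar X G A F] by auto
  from card_mono[OF _ this] have "card (homs ar X G A F) \<le> 1" by simp
  then show ?thesis by (simp add: True)
next
  case False
  let ?L = "A \<rightarrow>\<^sub>E insert None (Some ` X)"
  let ?J = "hom_fibre X A (homs ar X G A F)"
  have finL: "finite ?L" using finA X by (intro finite_PiE) auto
  have cardL: "card ?L = (card X + 1) ^ card A"
    using finA X by (simp add: card_PiE card_image)
  have "finite (?J \<rho>)" for \<rho>
    by (rule finite_subset[OF _ finite_homs[OF X(2) finA]]) (auto simp: hom_fibre_def)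
  then have "card (homs ar X G A F) \<le> card (\<Union>\<rho>\<in>?L. ?J \<rho>)"
    using finL by (intro card_mono homs_covered_by_fibres) auto
  also have "\<dots> \<le> (\<Sum>\<rho>\<in>?L. card (?J \<rho>))" by (rule card_UN_le[OF finL])
  also have "\<dots> \<le> (\<Sum>\<rho>\<in>?L. card X ^ (4 * card A ^ 3))"
    using card_hom_fibre_le[OF finA X False nsa] by (intro sum_mono)
  also have "\<dots> = (card X + 1) ^ card A * card X ^ (4 * card A ^ 3)" by (simp add: cardL)
  also have "\<dots> \<le> (card X + 1) ^ card A * (card X + 1) ^ (4 * card A ^ 3)"
    by (intro mult_left_mono power_mono) auto
  finally show ?thesis by (simp add: power_add)
qed

lemma count_fun_le:
  assumes "finite A"
    and "\<And>B \<theta>. subalgebra ar A F B \<Longrightarrow> congruence ar B F \<theta> \<Longrightarrow> \<theta> \<noteq> Id_on B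
      \<Longrightarrow> \<not> strongly_abelian ar B F \<theta>"
  shows "count_fun ar A F n \<le> (n + 1) ^ (card A + 4 * card A ^ 3)"
proof -
  let ?S = "{card (homs ar X G A F) | (X :: nat set) G. is_algebra ar X G \<and> finite X \<and> card X \<le> n}"
  have bound: "m \<le> (n + 1) ^ (card A + 4 * card A ^ 3)" if mS: "m \<in> ?S" for m
  proof -
    obtain X :: "nat set" and G where X: "is_algebra ar X G" "finite X" "card X \<le> n"
      and m: "m = card (homs ar X G A F)"
      using mS by blast
    have "m \<le> (card X + 1) ^ (card A + 4 * card A ^ 3)"
      unfolding m by (rule card_homs_le[OF assms(1) X(1,2) assms(2)])
    also have "\<dots> \<le> (n + 1) ^ (card A + 4 * card A ^ 3)" using X by (intro power_mono) auto
    finally show ?thesis .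
  qed
  show ?thesis
  proof (cases "?S = {}")
    \<comment> \<open>With a nullary symbol and \<open>n = 0\<close> no algebra qualifies; the
      supremum of the empty set of naturals is 0.\<close>
    case True
    then show ?thesis unfolding count_fun_def True by (simp add: Sup_nat_def)
  next
    case False
    then show ?thesis unfolding count_fun_def using bound by (intro cSup_least)
  qed
qed

lemma bigo_powr_of_le_power:
  fixes c :: "nat \<Rightarrow> nat"
  assumes "\<And>n. c n \<le> (n + 1) ^ d"
  shows "(\<lambda>n. real (c n)) \<in> O(\<lambda>n. real n powr real_of_int (int d))"
proof (rule bigoI[where c = "2 ^ d"])
  show "\<forall>\<^sub>F n in sequentially. norm (real (c n)) \<le> 2 ^ d * norm (real n powr real_of_int (int d))"
    using eventually_gt_at_top[of 0]
  proof eventually_elim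
    case (elim n)
    have "c n \<le> (2 * n) ^ d" using assms[of n] elim power_mono[of "n + 1" "2 * n" d] by linarith
    then have "real (c n) \<le> real ((2 * n) ^ d)" by linarith
    also have "\<dots> = 2 ^ d * real n ^ d" by (simp add: power_mult_distrib)
    finally show ?case using elim by (simp add: powr_realpow)
  qed
qed

section \<open>The exponential lower bound\<close>

fun rename :: "(nat \<Rightarrow> nat) \<Rightarrow> 'f trm \<Rightarrow> 'f trm" where
  "rename \<pi> (Var i) = Var (\<pi> i)"
| "rename \<pi> (App f ts) = App f (map (rename \<pi>) ts)"

lemma eval_rename: "eval_trm F v (rename \<pi> t) = eval_trm F (v \<circ> \<pi>) t"
proof (induction t)
  case (App f ts)
  then have "map (eval_trm F v) (map (rename \<pi>) ts) = map (eval_trm F (v \<circ> \<pi>)) ts" by (simp add: comp_def)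
  then show ?case by (simp only: rename.simps eval_trm.simps)
qed simp

lemma wf_rename: "wf_trm ar k t \<Longrightarrow> (\<And>i. i < k \<Longrightarrow> \<pi> i < k) \<Longrightarrow> wf_trm ar k (rename \<pi> t)"
  by (induction t) auto

text \<open>The definition singles out variable 0; exchanging variables 0 and \<open>i\<close> in
  the term carries it to any position.\<close>

lemma strongly_abelian_index:
  fixes x y z :: "nat \<Rightarrow> 'a"
  assumes sa: "strongly_abelian ar B F \<alpha>" and t: "wf_trm ar k t" and i: "i < k"
    and B: "\<And>j. j < k \<Longrightarrow> x j \<in> B \<and> y j \<in> B \<and> z j \<in> B"
    and rel: "\<And>j. j < k \<Longrightarrow> (x j, y j) \<in> \<alpha>" "\<And>j. j < k \<Longrightarrow> (y j, z j) \<in> \<alpha>"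
    and eq: "eval_trm F x t = eval_trm F y t"
  shows "eval_trm F (z(i := x i)) t = eval_trm F (z(i := y i)) t"
proof -
  define \<pi> where "\<pi> = id(0 := i, i := 0 :: nat)"
  have \<pi>: "\<pi> (\<pi> j) = j" "j < k \<Longrightarrow> \<pi> j < k" for j using i by (auto simp: \<pi>_def)
  then have invol: "v \<circ> \<pi> \<circ> \<pi> = v" for v :: "nat \<Rightarrow> 'a" by auto
  have upd: "(z \<circ> \<pi>)(0 := c) \<circ> \<pi> = z(i := c)" for c
    by (auto simp: \<pi>_def fun_eq_iff)
  have "eval_trm F ((z \<circ> \<pi>)(0 := (x \<circ> \<pi>) 0)) (rename \<pi> t)
      = eval_trm F ((z \<circ> \<pi>)(0 := (y \<circ> \<pi>) 0)) (rename \<pi> t)"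
    using sa[unfolded strongly_abelian_def, rule_format, of k "rename \<pi> t" "x \<circ> \<pi>" "y \<circ> \<pi>" "z \<circ> \<pi>"]
      wf_rename[OF t \<pi>(2)] i B rel eq \<pi>(2)
    by (simp add: eval_rename invol)
  moreover have "\<pi> 0 = i" by (auto simp: \<pi>_def)
  ultimately show ?thesis by (simp add: eval_rename upd)
qed

text \<open>Such a set is listed by a map from \<open>{..<q}\<close> to \<open>{..m}\<close>. The
  value \<open>m\<close> fills surplus positions and is removed by the intersection with
  \<open>{..<m}\<close>.\<close>

lemma card_bounded_subsets_le: "card {S. S \<subseteq> {..<m} \<and> card S \<le> q} \<le> (m + 1) ^ q"
proof -
  have "{S. S \<subseteq> {..<m} \<and> card S \<le> q} \<subseteq> (\<lambda>g. g ` {..<q} \<inter> {..<m}) ` ({..<q} \<rightarrow>\<^sub>E {..m})"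
  proof
    fix S assume "S \<in> {S. S \<subseteq> {..<m} \<and> card S \<le> q}"
    then have S: "S \<subseteq> {..<m}" "card S \<le> q" by auto
    then have "finite S" using finite_subset by blast
    then obtain h where h: "bij_betw h {0..<card S} S" using ex_bij_betw_nat_finite by blast
    define g where "g = (\<lambda>i\<in>{..<q}. if i < card S then h i else m)"
    have him: "h ` {0..<card S} = S" using h by (simp add: bij_betw_def)
    have "g \<in> {..<q} \<rightarrow>\<^sub>E {..m}" using him S by (force simp: g_def)
    moreover have "S = g ` {..<q} \<inter> {..<m}"
    proof
      show "S \<subseteq> g ` {..<q} \<inter> {..<m}"
      proof
        fix s assume "s \<in> S"
        then obtain i where "i < card S" "s = h i" using him by force
        then have "s = g i" "i < q" using S by (auto simp: g_def)
        then show "s \<in> g ` {..<q} \<inter> {..<m}" using \<open>s \<in> S\<close> S by auto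
      qed
      show "g ` {..<q} \<inter> {..<m} \<subseteq> S" using him by (force simp: g_def split: if_splits)
    qed
    ultimately show "S \<in> (\<lambda>g. g ` {..<q} \<inter> {..<m}) ` ({..<q} \<rightarrow>\<^sub>E {..m})" by blast
  qed
  moreover have fin: "finite ({..<q} \<rightarrow>\<^sub>E {..m})" by (intro finite_PiE) auto
  ultimately have "card {S. S \<subseteq> {..<m} \<and> card S \<le> q} \<le> card ({..<q} \<rightarrow>\<^sub>E {..m})"
    by (meson card_image_le card_mono finite_imageI le_trans)
  then show ?thesis by (simp add: card_PiE)
qed

locale strongly_abelian_pair =
  fixes ar :: "'f \<Rightarrow> nat" and B :: "'a set" and F :: "'f \<Rightarrow> 'a list \<Rightarrow> 'a"
    and \<alpha> :: "'a rel" and a b :: 'a and m :: nat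
  assumes algebra_B: "is_algebra ar B F" and finite_B: "finite B"
    and congr: "congruence ar B F \<alpha>" and sa: "strongly_abelian ar B F \<alpha>"
    and ab: "(a, b) \<in> \<alpha>" "a \<noteq> b"
begin

section \<open>The algebra of term operations on a two-element cube\<close>

definition V :: "(nat \<Rightarrow> 'a) set" where "V = {..<m} \<rightarrow>\<^sub>E {a, b}"

definition term_op :: "'f trm \<Rightarrow> (nat \<Rightarrow> 'a) \<Rightarrow> 'a" where
  "term_op t = (\<lambda>v\<in>V. eval_trm F v t)"

text \<open>With the pointwise operations \<open>G\<close>, this is the subalgebra of the power of
  \<open>B\<close> with exponent \<open>V\<close> that is generated by the \<open>m\<close>
  projections.\<close>

definition Y :: "((nat \<Rightarrow> 'a) \<Rightarrow> 'a) set" where "Y = {term_op t | t. wf_trm ar m t}"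

definition G :: "'f \<Rightarrow> ((nat \<Rightarrow> 'a) \<Rightarrow> 'a) list \<Rightarrow> (nat \<Rightarrow> 'a) \<Rightarrow> 'a" where
  "G f ys = (\<lambda>v\<in>V. F f (map (\<lambda>y. y v) ys))"

lemma ab_B: "a \<in> B" "b \<in> B" and ab_related: "c \<in> {a, b} \<Longrightarrow> d \<in> {a, b} \<Longrightarrow> (c, d) \<in> \<alpha>"
  using congr ab unfolding congruence_def equiv_def by (auto simp: refl_on_def dest: symD)

lemma V_val: "v \<in> V \<Longrightarrow> i < m \<Longrightarrow> v i \<in> {a, b}"
  unfolding V_def by blast

lemma card_V: "card V = 2 ^ m"
  using ab by (simp add: V_def card_PiE numeral_2_eq_2)

lemma eval_closed:
  assumes v: "v \<in> V"
  shows "wf_trm ar m t \<Longrightarrow> eval_trm F v t \<in> B"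
proof (induction t)
  case (Var i)
  then show ?case using V_val[OF v] ab_B by force
next
  case (App f ts)
  then have "length (map (eval_trm F v) ts) = ar f" "set (map (eval_trm F v) ts) \<subseteq> B" by auto
  then show ?case using algebra_B unfolding is_algebra_def eval_trm.simps by blast
qed

definition essential :: "'f trm \<Rightarrow> nat set" where
  "essential t = {i. i < m \<and> (\<exists>z\<in>V. eval_trm F (z(i := a)) t \<noteq> eval_trm F (z(i := b)) t)}"

text \<open>Equal values at \<open>u\<close> and \<open>v\<close> would, by strong abelianness, make
  the term insensitive to exchanging \<open>a\<close> and \<open>b\<close> in position
  \<open>i\<close> at every point of the cube.\<close>

lemma essential_injective:
  assumes t: "wf_trm ar m t" and uv: "u \<in> V" "v \<in> V" and i: "i \<in> essential t" "u i \<noteq> v i"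
  shows "eval_trm F u t \<noteq> eval_trm F v t"
proof
  assume eq: "eval_trm F u t = eval_trm F v t"
  obtain z where z: "z \<in> V" "eval_trm F (z(i := a)) t \<noteq> eval_trm F (z(i := b)) t" and im: "i < m"
    using i by (auto simp: essential_def)
  have "eval_trm F (z(i := u i)) t = eval_trm F (z(i := v i)) t"
  proof (rule strongly_abelian_index[OF sa t im _ _ _ eq])
    fix j assume "j < m"
    then have j: "u j \<in> {a, b}" "v j \<in> {a, b}" "z j \<in> {a, b}" using V_val uv z by blast+
    then show "u j \<in> B \<and> v j \<in> B \<and> z j \<in> B" using ab_B by auto
    show "(u j, v j) \<in> \<alpha>" "(v j, z j) \<in> \<alpha>" using j ab_related by blast+
  qed
  moreover have "u i \<in> {a, b}" "v i \<in> {a, b}" using V_val uv im by blast+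
  ultimately show False using z(2) i(2) by auto
qed

lemma card_essential_le:
  assumes t: "wf_trm ar m t"
  shows "card (essential t) \<le> card B"
proof (rule card_inj_on_le[OF _ _ finite_B])
  \<comment> \<open>Distinct essential indices give distinct values at these points.\<close>
  define w where "w j = (\<lambda>i\<in>{..<m}. if i = j then b else a)" for j
  have w: "w j \<in> V" for j by (auto simp: w_def V_def)
  show "(\<lambda>j. eval_trm F (w j) t) ` essential t \<subseteq> B" using eval_closed[OF w t] by blast
  show "inj_on (\<lambda>j. eval_trm F (w j) t) (essential t)"
  proof (rule inj_onI, rule ccontr)
    fix j j' assume j: "j \<in> essential t" "eval_trm F (w j) t = eval_trm F (w j') t" "j \<noteq> j'"
    then have "w j j \<noteq> w j' j" using ab by (auto simp: w_def essential_def)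
    then show False using essential_injective[OF t w w j(1)] j(2) by blast
  qed
qed

text \<open>Pass from \<open>u\<close> to \<open>v\<close> one coordinate at a time: essential
  coordinates already agree, and the others do not affect the value.\<close>

lemma eval_determined:
  assumes uv: "u \<in> V" "v \<in> V" and eq: "\<And>i. i \<in> essential t \<Longrightarrow> u i = v i"
  shows "eval_trm F u t = eval_trm F v t"
proof -
  define w where "w n = (\<lambda>i. if i < n then v i else u i)" for n :: nat
  have wV: "w n \<in> V" for n
    using uv unfolding w_def V_def by (auto simp: PiE_iff extensional_def)
  have "eval_trm F (w n) t = eval_trm F u t" if "n \<le> m" for n
    using that
  proof (induction n)
    case 0
    then show ?case by (simp add: w_def)
  next
    case (Suc n)
    have up: "w (Suc n) = (w n)(n := v n)" and same: "w n = (w n)(n := u n)"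
      by (auto simp: w_def fun_eq_iff less_Suc_eq)
    have vals: "u n \<in> {a, b}" "v n \<in> {a, b}" using V_val uv Suc.prems by auto
    have "eval_trm F ((w n)(n := u n)) t = eval_trm F ((w n)(n := v n)) t"
    proof (cases "n \<in> essential t")
      case False
      then have "eval_trm F ((w n)(n := a)) t = eval_trm F ((w n)(n := b)) t"
        using wV Suc.prems by (auto simp: essential_def)
      then show ?thesis using vals by auto
    qed (simp add: eq)
    then show ?case using up same Suc.IH Suc.prems by (metis Suc_leD)
  qed
  from this[of m] have "eval_trm F (w m) t = eval_trm F u t" by simp
  moreover have "w m = v"
    using uv unfolding w_def V_def by (auto simp: fun_eq_iff PiE_iff extensional_def)
  ultimately show ?thesis by simp
qed

text \<open>A term operation on the cube is determined by a set \<open>S\<close> of at most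
  \<open>q\<close> essential variables and a map from \<open>{a, b}\<close>-valued tuples on
  \<open>S\<close> to \<open>B\<close>. The first factor bounds the choices of \<open>S\<close>, the
  second the choices of the map.\<close>

lemma finite_Y: "finite Y" and card_Y_le: "card Y \<le> (m + 1) ^ card B * card B ^ 2 ^ card B"
proof -
  define q where "q = card B"
  have q: "0 < q" using ab_B finite_B by (auto simp: q_def card_gt_0_iff)
  define \<S> where "\<S> = {S. S \<subseteq> {..<m} \<and> card S \<le> q}"
  define \<Phi> where "\<Phi> S = (\<lambda>\<phi>. \<lambda>v\<in>V. \<phi> (restrict v S)) ` ((S \<rightarrow>\<^sub>E {a, b}) \<rightarrow>\<^sub>E B)" for S :: "nat set"
  have fin\<S>: "finite \<S>" unfolding \<S>_def by simp
  have finS: "finite S" if "S \<in> \<S>" for S using that finite_subset by (auto simp: \<S>_def)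
  have fin: "finite (S \<rightarrow>\<^sub>E {a, b})" "finite ((S \<rightarrow>\<^sub>E {a, b}) \<rightarrow>\<^sub>E B)" if "S \<in> \<S>" for S
    using finS[OF that] finite_B by (auto intro!: finite_PiE)
  have card: "card (\<Phi> S) \<le> q ^ 2 ^ q" if S: "S \<in> \<S>" for S
  proof -
    have "card (\<Phi> S) \<le> card ((S \<rightarrow>\<^sub>E {a, b}) \<rightarrow>\<^sub>E B)"
      unfolding \<Phi>_def using fin[OF S] by (intro card_image_le)
    also have "\<dots> = q ^ 2 ^ card S"
      using fin[OF S] finS[OF S] ab by (simp add: card_PiE q_def numeral_2_eq_2)
    also have "\<dots> \<le> q ^ 2 ^ q" using S q by (intro power_increasing) (auto simp: \<S>_def)
    finally show ?thesis .
  qed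
  have sub: "Y \<subseteq> (\<Union>S\<in>\<S>. \<Phi> S)"
  proof
    fix y assume "y \<in> Y"
    then obtain t where t: "wf_trm ar m t" "y = term_op t" by (auto simp: Y_def)
    define S where "S = essential t"
    have S: "S \<in> \<S>" using card_essential_le[OF t(1)] by (auto simp: \<S>_def S_def q_def essential_def)
    then have Sm: "S \<subseteq> {..<m}" by (simp add: \<S>_def)
    \<comment> \<open>The inessential coordinates are filled with the default \<open>a\<close> to
      obtain a point of the cube.\<close>
    define ext where "ext s = (\<lambda>i\<in>{..<m}. if i \<in> S then s i else a)" for s
    have extV: "ext s \<in> V" if "s \<in> S \<rightarrow>\<^sub>E {a, b}" for s
      using that by (auto simp: ext_def V_def PiE_iff)
    define \<phi> where "\<phi> = (\<lambda>s\<in>S \<rightarrow>\<^sub>E {a, b}. eval_trm F (ext s) t)"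
    have "\<phi> \<in> (S \<rightarrow>\<^sub>E {a, b}) \<rightarrow>\<^sub>E B"
      using eval_closed[OF extV t(1)] by (auto simp: \<phi>_def)
    moreover have "y = (\<lambda>v\<in>V. \<phi> (restrict v S))"
      unfolding t(2) term_op_def
    proof (rule restrict_ext)
      fix v assume v: "v \<in> V"
      have r: "restrict v S \<in> S \<rightarrow>\<^sub>E {a, b}" using V_val[OF v] Sm by (auto simp: PiE_iff)
      have "eval_trm F v t = eval_trm F (ext (restrict v S)) t"
        using Sm by (intro eval_determined v extV[OF r]) (auto simp: ext_def S_def)
      then show "eval_trm F v t = \<phi> (restrict v S)" using r by (simp add: \<phi>_def)
    qed
    ultimately show "y \<in> (\<Union>S\<in>\<S>. \<Phi> S)" using S unfolding \<Phi>_def by blast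
  qed
  have finU: "finite (\<Union>S\<in>\<S>. \<Phi> S)" using fin fin\<S> by (auto simp: \<Phi>_def)
  show "finite Y" by (rule finite_subset[OF sub finU])
  have "card Y \<le> card (\<Union>S\<in>\<S>. \<Phi> S)" by (rule card_mono[OF finU sub])
  also have "\<dots> \<le> (\<Sum>S\<in>\<S>. card (\<Phi> S))" by (rule card_UN_le[OF fin\<S>])
  also have "\<dots> \<le> (\<Sum>S\<in>\<S>. q ^ 2 ^ q)" using card by (rule sum_mono)
  also have "\<dots> \<le> (m + 1) ^ q * q ^ 2 ^ q"
    using card_bounded_subsets_le[of m q] by (simp add: \<S>_def)
  finally show "card Y \<le> (m + 1) ^ card B * card B ^ 2 ^ card B" by (simp add: q_def)
qed

lemma algebra_Y: "is_algebra ar Y G"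
  unfolding is_algebra_def
proof (intro allI impI)
  fix f ys assume ys: "length ys = ar f \<and> set ys \<subseteq> Y"
  then have "\<forall>y\<in>set ys. \<exists>t. y = term_op t \<and> wf_trm ar m t" by (auto simp: Y_def)
  then obtain Z where Z: "\<And>y. y \<in> set ys \<Longrightarrow> y = term_op (Z y) \<and> wf_trm ar m (Z y)" by metis
  have "G f ys = term_op (App f (map Z ys))"
    unfolding G_def term_op_def
  proof (rule restrict_ext)
    fix v assume v: "v \<in> V"
    have "y v = eval_trm F v (Z y)" if "y \<in> set ys" for y
      using arg_cong[OF conjunct1[OF Z[OF that]], of "\<lambda>y. y v"] v by (simp add: term_op_def)
    then have "map (\<lambda>y. y v) ys = map (eval_trm F v) (map Z ys)" by simp
    then show "F f (map (\<lambda>y. y v) ys) = eval_trm F v (App f (map Z ys))"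
      by (simp only: eval_trm.simps)
  qed
  moreover have "wf_trm ar m (App f (map Z ys))" using Z ys by auto
  ultimately show "G f ys \<in> Y" unfolding Y_def by blast
qed

lemma evaluation_hom:
  assumes v: "v \<in> V" and "B \<subseteq> A"
  shows "(\<lambda>y\<in>Y. y v) \<in> homs ar Y G A F"
  unfolding homs_def is_hom_def
proof (intro CollectI conjI ballI allI impI)
  fix y assume "y \<in> Y"
  then show "(\<lambda>y\<in>Y. y v) y \<in> A"
    using eval_closed[OF v] v assms(2) by (auto simp: Y_def term_op_def)
next
  fix f ys assume ys: "length ys = ar f \<and> set ys \<subseteq> Y"
  then have "G f ys \<in> Y" using algebra_Y unfolding is_algebra_def by blast
  then have "(\<lambda>y\<in>Y. y v) (G f ys) = F f (map (\<lambda>y. y v) ys)" using v by (simp add: G_def)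
  also have "map (\<lambda>y. y v) ys = map (\<lambda>y\<in>Y. y v) ys" using ys by auto
  finally show "(\<lambda>y\<in>Y. y v) (G f ys) = F f (map (\<lambda>y\<in>Y. y v) ys)" .
qed simp

text \<open>Distinct points of the cube give distinct evaluations because the projections belong to
  \<open>Y\<close>.\<close>

lemma card_homs_ge:
  assumes "B \<subseteq> A" "finite A"
  shows "2 ^ m \<le> card (homs ar Y G A F)"
proof -
  have "inj_on (\<lambda>v. \<lambda>y\<in>Y. y v) V"
  proof (rule inj_onI)
    fix u v assume uv: "u \<in> V" "v \<in> V" "(\<lambda>y\<in>Y. y u) = (\<lambda>y\<in>Y. y v)"
    have "u i = v i" if "i < m" for i
    proof -
      have "term_op (Var i) \<in> Y" using that by (auto simp: Y_def intro!: exI[of _ "Var i"])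
      then have "term_op (Var i) u = term_op (Var i) v" using uv(3) by (metis restrict_apply')
      then show ?thesis using uv by (simp add: term_op_def)
    qed
    then show "u = v" using uv unfolding V_def by (intro PiE_ext) auto
  qed
  then have "card V \<le> card (homs ar Y G A F)"
    using evaluation_hom assms finite_homs[OF finite_Y]
    by (intro card_inj_on_le[of "\<lambda>v. \<lambda>y\<in>Y. y v"]) auto
  then show ?thesis by (simp add: card_V)
qed

end

text \<open>The supremum in \<open>count_fun\<close> ranges over carriers in \<open>nat\<close>,
  whereas \<open>Y\<close> consists of functions; its structure is transported along a
  bijection.\<close>

lemma nat_copy:
  fixes Y :: "'b set" and A :: "'a set"
  assumes Y: "is_algebra ar Y G" "finite Y" and "finite A"
  shows "\<exists>(X :: nat set) G'. is_algebra ar X G' \<and> finite X \<and> card X = card Y \<and>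
    card (homs ar Y G A F) \<le> card (homs ar X G' A F)"
proof -
  define X where "X = {0..<card Y}"
  obtain j where j: "bij_betw j Y X" unfolding X_def using ex_bij_betw_finite_nat[OF Y(2)] by blast
  define k where "k = inv_into Y j"
  have k: "bij_betw k X Y" unfolding k_def by (rule bij_betw_inv_into[OF j])
  have kj: "k (j y) = y" if "y \<in> Y" for y using j that by (simp add: k_def bij_betw_inv_into_left)
  have kY: "k x \<in> Y" if "x \<in> X" for x using k that by (auto simp: bij_betw_def)
  have jX: "j y \<in> X" if "y \<in> Y" for y using j that by (auto simp: bij_betw_def)
  define G' where "G' f xs = j (G f (map k xs))" for f xs
  have GY: "G f (map k xs) \<in> Y" if "length xs = ar f" "set xs \<subseteq> X" for f xs
  proof -
    have "length (map k xs) = ar f" "set (map k xs) \<subseteq> Y" using that kY by auto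
    then show ?thesis using Y(1) unfolding is_algebra_def by blast
  qed
  have alg: "is_algebra ar X G'" unfolding is_algebra_def G'_def using GY jX by blast
  define \<Theta> where "\<Theta> h = (\<lambda>x\<in>X. h (k x))" for h :: "'b \<Rightarrow> 'a"
  have "\<Theta> h \<in> homs ar X G' A F" if h: "h \<in> homs ar Y G A F" for h
    unfolding homs_def is_hom_def
  proof (intro CollectI conjI ballI allI impI)
    fix x assume "x \<in> X"
    then show "\<Theta> h x \<in> A" using h kY by (auto simp: \<Theta>_def homs_def is_hom_def)
  next
    fix f xs assume xs: "length xs = ar f \<and> set xs \<subseteq> X"
    have args: "length (map k xs) = ar f" "set (map k xs) \<subseteq> Y" using xs kY by auto
    have "\<Theta> h (G' f xs) = h (G f (map k xs))"
      using GY xs jX kj by (simp add: \<Theta>_def G'_def)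
    also have "\<dots> = F f (map h (map k xs))" using hom_app[OF h args] .
    also have "map h (map k xs) = map (\<Theta> h) xs" using xs by (auto simp: \<Theta>_def)
    finally show "\<Theta> h (G' f xs) = F f (map (\<Theta> h) xs)" .
  qed (simp add: \<Theta>_def)
  moreover have "inj_on \<Theta> (homs ar Y G A F)"
  proof (rule inj_onI)
    fix h h' assume h: "h \<in> homs ar Y G A F" "h' \<in> homs ar Y G A F" "\<Theta> h = \<Theta> h'"
    have "h y = h' y" if "y \<in> Y" for y
      using fun_cong[OF h(3), of "j y"] that jX kj by (simp add: \<Theta>_def)
    then show "h = h'" using h(1,2) homs_subset_PiE[of ar Y G A F] by (meson PiE_ext subsetD)
  qed
  moreover have "finite X" by (simp add: X_def)
  ultimately have "card (homs ar Y G A F) \<le> card (homs ar X G' A F)"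
    using finite_homs[of X A ar G' F] assms(3) by (intro card_inj_on_le[of \<Theta>]) auto
  then show ?thesis using alg \<open>finite X\<close> by (intro exI[of _ X] exI[of _ G']) (simp add: X_def)
qed

lemma count_fun_ge:
  fixes Y :: "'b set"
  assumes Y: "is_algebra ar Y G" "finite Y" "card Y \<le> n" and finA: "finite A"
  shows "card (homs ar Y G A F) \<le> count_fun ar A F n"
proof -
  let ?S = "{card (homs ar X G A F) | (X :: nat set) G. is_algebra ar X G \<and> finite X \<and> card X \<le> n}"
  obtain X :: "nat set" and G' where X: "is_algebra ar X G'" "finite X" "card X = card Y"
    and le: "card (homs ar Y G A F) \<le> card (homs ar X G' A F)"
    using nat_copy[OF Y(1,2) finA] by blast
  \<comment> \<open>A supremum of naturals is an upper bound only for a bounded set. The bound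
    counts all maps; adding 1 to \<open>card A\<close> keeps the base positive when \<open>A\<close>
    is empty.\<close>
  have "bdd_above ?S"
  proof (rule bdd_aboveI)
    fix s assume "s \<in> ?S"
    then obtain X :: "nat set" and G where X: "finite X" "card X \<le> n" and s: "s = card (homs ar X G A F)"
      by blast
    have "s \<le> card (X \<rightarrow>\<^sub>E A)"
      unfolding s using X finA by (intro card_mono homs_subset_PiE finite_PiE) auto
    also have "\<dots> \<le> (card A + 1) ^ card X" using X by (simp add: card_PiE power_mono)
    also have "\<dots> \<le> (card A + 1) ^ n" using X by (intro power_increasing) auto
    finally show "s \<le> (card A + 1) ^ n" .
  qed
  moreover have "card (homs ar X G' A F) \<in> ?S"
    using X Y(3) by (intro CollectI exI[of _ X] exI[of _ G'] conjI) auto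
  ultimately have "card (homs ar X G' A F) \<le> count_fun ar A F n"
    unfolding count_fun_def by (intro cSup_upper)
  then show ?thesis using le by simp
qed

lemma exponential_exceeds_polynomial:
  fixes c :: real
  shows "\<exists>m\<ge>N. c * real (m + 1) ^ e < 2 ^ m"
proof -
  obtain j0 :: nat where j0: "\<bar>c\<bar> * real (e + 2) ^ e < real j0" using reals_Archimedean2 by blast
  define j where "j = j0 + N + 1"
  \<comment> \<open>\<open>2\<^sup>m\<close> is then \<open>2\<^sup>j\<close> times \<open>(2\<^sup>j)\<^sup>e \<ge> j\<^sup>e\<close>.\<close>
  define m where "m = (e + 1) * j"
  have "m + 1 \<le> (e + 2) * j" by (simp add: m_def j_def)
  then have "real (m + 1) ^ e \<le> real ((e + 2) * j) ^ e" by (intro power_mono) (auto simp only: of_nat_le_iff)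
  then have "c * real (m + 1) ^ e \<le> \<bar>c\<bar> * real ((e + 2) * j) ^ e"
    by (intro mult_mono) auto
  also have "\<dots> = (\<bar>c\<bar> * real (e + 2) ^ e) * real j ^ e"
    by (simp only: of_nat_mult power_mult_distrib mult.assoc)
  also have "\<dots> < real j * real j ^ e"
    using j0 by (intro mult_strict_right_mono) (auto simp: j_def)
  also have "\<dots> \<le> 2 ^ j * (2 ^ j) ^ e"
    using of_nat_less_two_power[of j, where 'a = real]
    by (intro mult_mono power_mono) (auto simp: less_imp_le)
  also have "\<dots> = 2 ^ m" by (simp add: m_def power_mult[symmetric] power_add[symmetric] algebra_simps)
  finally show ?thesis by (intro exI[of _ m]) (simp add: m_def j_def)
qed

text \<open>The algebra of term operations has at most \<open>n = (m + 1) ^ q * C\<close> elements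
  and at least \<open>2 ^ m\<close> homomorphisms into \<open>A\<close>. A bound polynomial in
  \<open>n\<close> would be polynomial in \<open>m\<close>, since \<open>q\<close> and
  \<open>C\<close> do not depend on \<open>m\<close>.\<close>

lemma not_polynomial_if_strongly_abelian:
  fixes ar :: "'f \<Rightarrow> nat" and A :: "'a set" and F :: "'f \<Rightarrow> 'a list \<Rightarrow> 'a" and k :: int
  assumes finA: "finite A" and sub: "subalgebra ar A F B"
    and congr: "congruence ar B F \<alpha>" "\<alpha> \<noteq> Id_on B" and sa: "strongly_abelian ar B F \<alpha>"
  shows "(\<lambda>n. real (count_fun ar A F n)) \<notin> O(\<lambda>n. real n powr real_of_int k)"
proof
  assume "(\<lambda>n. real (count_fun ar A F n)) \<in> O(\<lambda>n. real n powr real_of_int k)"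
  then obtain c where c: "0 < c"
    "\<forall>\<^sub>F n in sequentially. norm (real (count_fun ar A F n)) \<le> c * norm (real n powr real_of_int k)"
    by (rule landau_o.bigE)
  then obtain N where N: "\<And>n. n \<ge> N \<Longrightarrow> real (count_fun ar A F n) \<le> c * real n powr real_of_int k"
    by (auto simp: eventually_sequentially)
  have BA: "B \<subseteq> A" "is_algebra ar B F" using sub by (auto simp: subalgebra_def)
  then have finB: "finite B" using finA finite_subset by blast
  have "Id_on B \<subseteq> \<alpha>" using congr by (auto simp: congruence_def equiv_def refl_on_def)
  moreover have "\<alpha> \<subseteq> B \<times> B" using congr by (auto simp: congruence_def equiv_def)
  ultimately obtain a b where ab: "(a, b) \<in> \<alpha>" "a \<noteq> b" using congr(2) by blast
  define q where "q = card B"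
  have "a \<in> B" using ab \<open>\<alpha> \<subseteq> B \<times> B\<close> by blast
  then have q: "0 < q" using finB by (auto simp: q_def card_gt_0_iff)
  define C where "C = q ^ 2 ^ q"
  have C: "1 \<le> C" using q by (simp add: C_def Suc_le_eq)
  \<comment> \<open>The exponent \<open>k\<close> may be negative; truncating it to a natural number
    only weakens the bound because \<open>n\<close> is at least 1.\<close>
  define d where "d = nat k"
  obtain m where m: "m \<ge> N" "c * real C ^ d * real (m + 1) ^ (q * d) < 2 ^ m"
    using exponential_exceeds_polynomial by blast
  interpret strongly_abelian_pair ar B F \<alpha> a b m
    by unfold_locales (use BA finB congr sa ab in auto)
  define n where "n = (m + 1) ^ q * C"
  have "m + 1 \<le> (m + 1) ^ q" using q by (intro self_le_power) auto
  also have "\<dots> \<le> n" using C by (simp add: n_def)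
  finally have n: "m + 1 \<le> n" .
  have "2 ^ m \<le> card (homs ar Y G A F)" by (rule card_homs_ge[OF BA(1) finA])
  also have "\<dots> \<le> count_fun ar A F n"
    using card_Y_le by (intro count_fun_ge[OF algebra_Y finite_Y _ finA]) (simp add: n_def C_def q_def)
  finally have "2 ^ m \<le> count_fun ar A F n" .
  then have "real (2 ^ m) \<le> real (count_fun ar A F n)" by (simp only: of_nat_le_iff)
  also have "\<dots> \<le> c * real n powr real_of_int k" using N n m(1) by simp
  also have "\<dots> \<le> c * real n powr real d"
    using c(1) n by (intro mult_left_mono powr_mono) (auto simp: d_def)
  also have "real n powr real d = real n ^ d" using n by (intro powr_realpow) auto
  also have "real n = real (m + 1) ^ q * real C" by (simp add: n_def)
  also have "c * (real (m + 1) ^ q * real C) ^ d = c * real C ^ d * real (m + 1) ^ (q * d)"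
    by (simp add: power_mult_distrib power_mult)
  finally show False using m(2) by simp
qed

theorem theorem1p1:
  fixes ar :: "'f \<Rightarrow> nat" and A :: "'a set" and F :: "'f \<Rightarrow> 'a list \<Rightarrow> 'a"
  assumes "is_algebra ar A F" and "finite A"
  shows "(\<exists>k::int. (\<lambda>n. real (count_fun ar A F n)) \<in> O(\<lambda>n. real n powr real_of_int k))
     \<longleftrightarrow> (\<forall>B. subalgebra ar A F B \<longrightarrow>
            \<not> (\<exists>\<alpha>. congruence ar B F \<alpha> \<and> \<alpha> \<noteq> Id_on B \<and> strongly_abelian ar B F \<alpha>))"
    (is "?poly \<longleftrightarrow> ?nsa")
proof
  assume ?poly
  then show ?nsa using not_polynomial_if_strongly_abelian[OF assms(2)] by metis
next
  assume ?nsa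
  then have "count_fun ar A F n \<le> (n + 1) ^ (card A + 4 * card A ^ 3)" for n
    by (intro count_fun_le[OF assms(2)]) blast
  from bigo_powr_of_le_power[of "count_fun ar A F", OF this] show ?poly by blast
qed

end
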